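(* Let $G$ be a simple 2-connected graph of order $n\ge 8$. If $G$ is $\{K_{1,3}, P_5\}$-free, then $G$ is chorded pancyclic.
   Context: $G$ is $\{H_1,\dots,H_r\}$-free if $G$ contains no induced subgraph isomorphic to any $H_i$. $K_{1,3}$ is the claw and $P_t$ denotes the path on $t$ vertices. A chorded cycle is a cycle $C$ such that $G$ has an edge joining two vertices nonconsecutive on $C$. A graph $G$ of order $n$ is chorded pancyclic if it contains a chorded cycle of every length $m$ with $4\le m\le n$. *)

theory Defs
  imports "Graph_Theory.Graph_Theory"
begin

text \<open>
  A finite simple graph is a symmetric digraph in the sense of the locale \<^locale>\<open>graph\<close>:
  an undirected edge is the pair of its two opposite arcs, and there are no loops
  and no parallel arcs.
\<close>

definition star_graph :: "nat \<Rightarrow> nat pair_pre_digraph" where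
  "star_graph s = \<lparr> pverts = {0..s}, parcs = {0} \<times> {1..s} \<union> {1..s} \<times> {0} \<rparr>"

definition path_graph :: "nat \<Rightarrow> nat pair_pre_digraph" where
  "path_graph t = \<lparr> pverts = {..<t},
     parcs = {(i, j). i < t \<and> j < t \<and> (j = Suc i \<or> i = Suc j)} \<rparr>"

lemma pair_graph_star_graph: "pair_graph (star_graph s)"
  by unfold_locales
    (auto simp: star_graph_def symmetric_def sym_def arcs_ends_def arc_to_ends_def)

lemma star_graph_complete_bipartite: "complete_bipartite_digraph 1 s (with_proj (star_graph s))"
proof -
  interpret pair_graph "star_graph s" by (rule pair_graph_star_graph)
  show ?thesis
    unfolding complete_bipartite_digraph_def
    by (intro conjI exI[of _ "{0}"] exI[of _ "{1..s}"] graph_axioms)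
      (auto simp: star_graph_def arcs_ends_def arc_to_ends_def)
qed

lemma pair_graph_path_graph: "pair_graph (path_graph t)"
proof -
  have "finite {(i, j). i < t \<and> j < t \<and> (j = Suc i \<or> i = Suc j)}"
    by (rule finite_subset[of _ "{..<t} \<times> {..<t}"]) auto
  then show ?thesis
    by unfold_locales
      (auto simp: path_graph_def symmetric_def sym_def arcs_ends_def arc_to_ends_def)
qed

definition induced_free :: "('c, 'd) pre_digraph set \<Rightarrow> ('a, 'b) pre_digraph \<Rightarrow> bool" where
  "induced_free \<H> G \<longleftrightarrow> (\<forall>F \<in> \<H>. \<not> (\<exists>H. induced_subgraph H G \<and> digraph_iso H F))"

definition k_connected :: "nat \<Rightarrow> ('a, 'b) pre_digraph \<Rightarrow> bool" where
  "k_connected k G \<longleftrightarrow> k < card (verts G) \<and>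
     (\<forall>S \<subseteq> verts G. card S < k \<longrightarrow> connected (G \<restriction> (verts G - S)))"

text \<open>
  The library's \<^const>\<open>pre_digraph.cycle\<close> is a closed list of arcs without repeated
  vertices; in a symmetric digraph it also admits going back and forth along one edge,
  which the bound 3 excludes. The vertices of the cycle are the tails of its arcs, and
  two of them are consecutive iff an arc of the cycle joins them in one of the directions.
\<close>

definition chorded_cycle :: "('a, 'b) pre_digraph \<Rightarrow> 'b awalk \<Rightarrow> bool" where
  "chorded_cycle G p \<longleftrightarrow> pre_digraph.cycle G p \<and> 3 \<le> length p \<and>
     (\<exists>u \<in> tail G ` set p. \<exists>v \<in> tail G ` set p. (u, v) \<in> arcs_ends G \<and>
        (u, v) \<notin> arc_to_ends G ` set p \<and> (v, u) \<notin> arc_to_ends G ` set p)"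

definition chorded_pancyclic :: "('a, 'b) pre_digraph \<Rightarrow> bool" where
  "chorded_pancyclic G \<longleftrightarrow>
     (\<forall>m. 4 \<le> m \<and> m \<le> card (verts G) \<longrightarrow> (\<exists>p. chorded_cycle G p \<and> length p = m))"

end

theory Submission
  imports Defs
begin

text \<open>
  Let \<open>C\<close> be a longest cycle and suppose that it misses a vertex. Since no cycle is longer, a shortest
  detour outside \<open>C\<close> between two vertices \<open>a\<close>, \<open>b\<close> of \<open>C\<close> extends along \<open>C\<close> to an induced
  \<open>P\<^sub>5\<close>, unless it is a single vertex \<open>v\<close> and \<open>a\<close>, \<open>b\<close> are adjacent. In that case every further vertex of
  \<open>C\<close> is adjacent to \<open>a\<close> or \<open>b\<close> but not to \<open>v\<close>; having no claw at \<open>a\<close> and \<open>b\<close>, these vertices form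
  two cliques, through which \<open>v\<close> can be inserted. So there is a Hamiltonian cycle. A cycle of length
  at least 6 can be shortened by one, as otherwise the chords forced by the two forbidden subgraphs
  (vertices at distance 4 are adjacent) produce the shorter cycle after all, and it has a chord
  because five consecutive vertices of it do not induce \<open>P\<^sub>5\<close>.

  The lengths 5 and 4 are separate. A vertex adjacent to an induced pentagon sees at least three
  consecutive vertices of it; three such vertices always create a chorded 5-cycle. Without a
  chorded 4-cycle, any 6-cycle consists of two triangles joined by two or three disjoint edges, and no
  further vertex can be attached to it.
\<close>

text \<open>The arcs of the digraph are forgotten; a vertex set and an adjacency relation remain.
  \<open>separation\<close> is 2-connectedness in the form in which it gets applied: after deleting
  at most one vertex, some edge leaves every nonempty proper part of the rest.\<close>

locale claw_P5_free =
  fixes V :: "'a set" and adj :: "'a \<Rightarrow> 'a \<Rightarrow> bool" (infix \<open>\<sim>\<close> 50)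
  assumes finite_V: "finite V"
    and adj_V: "u \<sim> v \<Longrightarrow> u \<in> V"
    and adj_sym: "u \<sim> v \<Longrightarrow> v \<sim> u"
    and adj_irrefl: "\<not> u \<sim> u"
    and claw_free: "\<lbrakk>c \<sim> x; c \<sim> y; c \<sim> z; x \<noteq> y; x \<noteq> z; y \<noteq> z\<rbrakk> \<Longrightarrow> x \<sim> y \<or> x \<sim> z \<or> y \<sim> z"
    and P5_free: "\<lbrakk>a \<sim> b; b \<sim> c; c \<sim> d; d \<sim> e\<rbrakk>
      \<Longrightarrow> a \<sim> c \<or> a \<sim> d \<or> a \<sim> e \<or> b \<sim> d \<or> b \<sim> e \<or> c \<sim> e"
    and separation: "\<lbrakk>A \<subseteq> V; card A < 2; S \<subseteq> V - A; S \<noteq> {}; V - A - S \<noteq> {}\<rbrakk>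
      \<Longrightarrow> \<exists>s\<in>S. \<exists>t\<in>V - A - S. s \<sim> t"
begin

section \<open>Adjacency and cycles as vertex lists\<close>

text \<open>
  In the axiom on induced paths, distinctness of the five vertices follows from the non-adjacencies.
\<close>

lemma adj_commute: "u \<sim> v \<longleftrightarrow> v \<sim> u"
  using adj_sym by blast

lemma adj_neq: "u \<sim> v \<Longrightarrow> u \<noteq> v"
  using adj_irrefl by blast

text \<open>
  An edge counts as a cycle of length 2, so that a longest cycle exists from the outset.
\<close>

definition cyc :: "'a list \<Rightarrow> bool" where
  "cyc xs \<longleftrightarrow> xs \<noteq> [] \<and> distinct xs \<and> successively (\<sim>) xs \<and> last xs \<sim> hd xs"

text \<open>Simplifying \<open>successively\<close> on a reversed list leaves the flipped relation
  behind; this rule removes it.\<close>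

lemma successively_adj_flip [simp]: "successively (\<lambda>x y. y \<sim> x) xs \<longleftrightarrow> successively (\<sim>) xs"
  by (simp add: adj_commute)

lemma cyc_rotate: "cyc (xs @ ys) \<Longrightarrow> cyc (ys @ xs)"
  by (cases "xs = []"; cases "ys = []") (auto simp: cyc_def successively_append_iff)

lemma cyc_rev: "cyc xs \<Longrightarrow> cyc (rev xs)"
  by (auto simp: cyc_def hd_rev last_rev intro: adj_sym)

lemma cyc_subset: assumes "cyc xs" shows "set xs \<subseteq> V"
proof
  fix x assume "x \<in> set xs"
  then obtain ys zs where "xs = ys @ x # zs" by (meson split_list)
  then have "cyc (x # zs @ ys)" using assms cyc_rotate[of ys "x # zs"] by simp
  then show "x \<in> V" by (cases "zs @ ys") (auto simp: cyc_def intro: adj_V)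
qed

lemma cyc_length_le: "cyc xs \<Longrightarrow> length xs \<le> card V"
  using cyc_subset[of xs] finite_V card_mono[of V "set xs"] distinct_card[of xs]
  by (auto simp: cyc_def)

section \<open>Detours of a longest cycle\<close>

text \<open>The list holds only the interior vertices of a path. That they avoid the cycle is stated
  separately, since the cycle is not an argument here.\<close>

definition link :: "'a \<Rightarrow> 'a list \<Rightarrow> 'a \<Rightarrow> bool" where
  "link a vs b \<longleftrightarrow> vs \<noteq> [] \<and> distinct vs \<and> successively (\<sim>) vs \<and> a \<sim> hd vs \<and> last vs \<sim> b"

lemma link_rev: "link a vs b \<Longrightarrow> link b (rev vs) a"
  by (auto simp: link_def hd_rev last_rev intro: adj_sym)

definition longest :: "'a list \<Rightarrow> bool" where
  "longest xs \<longleftrightarrow> cyc xs \<and> (\<forall>ys. cyc ys \<longrightarrow> length ys \<le> length xs)"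

text \<open>The successor of \<open>a\<close> on the cycle is \<open>hd zs\<close>, so the detour
  could be inserted between the two, giving a longer cycle.\<close>

lemma longest_no_link:
  assumes "longest (a # zs)" "set vs \<inter> set (a # zs) = {}"
  shows "\<not> link a vs (hd zs)"
proof
  assume l: "link a vs (hd zs)"
  have c: "cyc (a # zs)" using assms by (simp add: longest_def)
  have "zs \<noteq> []" using c adj_irrefl by (auto simp: cyc_def)
  then have "cyc (a # vs @ zs)" using l c assms(2)
    by (auto simp: cyc_def link_def successively_Cons successively_append_iff)
  then show False using assms(1) l by (fastforce simp: longest_def link_def)
qed

text \<open>The cycle is rotated so that \<open>a\<close> comes first and \<open>b\<close> cuts the
  rest into two segments, which turn out to be nonempty. The neighbours of \<open>a\<close> on it
  are \<open>hd X\<close> and \<open>last Y\<close>, those of \<open>b\<close> are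
  \<open>last X\<close> and \<open>hd Y\<close>. A fact about \<open>hd X\<close> therefore gives
  its three variants by \<open>ear_swap\<close> and \<open>ear_reverse\<close>.\<close>

definition ear :: "'a \<Rightarrow> 'a list \<Rightarrow> 'a \<Rightarrow> 'a list \<Rightarrow> 'a list \<Rightarrow> bool" where
  "ear a X b Y vs \<longleftrightarrow> longest (a # X @ b # Y) \<and> link a vs b \<and> set vs \<inter> set (a # X @ b # Y) = {}"

lemma longest_rotate: "longest (xs @ ys) \<Longrightarrow> longest (ys @ xs)"
  by (auto simp: longest_def intro: cyc_rotate)

lemma longest_rev: "longest xs \<Longrightarrow> longest (rev xs)"
  by (auto simp: longest_def intro: cyc_rev)

lemma ear_swap: assumes "ear a X b Y vs" shows "ear b Y a X (rev vs)"
  using assms longest_rotate[of "a # X" "b # Y"] link_rev by (auto simp: ear_def)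

lemma ear_reverse: assumes "ear a X b Y vs" shows "ear a (rev Y) b (rev X) vs"
  using assms longest_rotate[of "rev Y @ b # rev X" "[a]"] longest_rev[of "a # X @ b # Y"]
  by (auto simp: ear_def)

lemma ear_nonempty1: assumes "ear a X b Y vs" shows "X \<noteq> []"
  using assms longest_no_link[of a "X @ b # Y" vs] by (auto simp: ear_def)

lemma ear_nonempty: assumes "ear a X b Y vs" shows "X \<noteq> []" "Y \<noteq> []"
  using ear_nonempty1[OF assms] ear_nonempty1[OF ear_swap[OF assms]] by auto

text \<open>Otherwise the single vertex \<open>hd vs\<close> could be inserted between
  \<open>a\<close> and its successor.\<close>

lemma ear_hd_nonadj1: assumes e: "ear a X b Y vs" shows "\<not> hd vs \<sim> hd X"
proof
  assume "hd vs \<sim> hd X"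
  then have "link a [hd vs] (hd (X @ b # Y))"
    using e ear_nonempty[OF e] by (auto simp: ear_def link_def)
  moreover have "set [hd vs] \<inter> set (a # X @ b # Y) = {}"
    using e by (cases vs) (auto simp: ear_def link_def)
  ultimately show False using longest_no_link e by (auto simp: ear_def)
qed

lemma ear_hd_nonadj:
  assumes e: "ear a X b Y vs" shows "\<not> hd vs \<sim> hd X" "\<not> hd vs \<sim> last Y"
    "\<not> last vs \<sim> last X" "\<not> last vs \<sim> hd Y"
proof -
  have "vs \<noteq> []" using e by (auto simp: ear_def link_def)
  then show "\<not> hd vs \<sim> hd X" "\<not> hd vs \<sim> last Y"
    "\<not> last vs \<sim> last X" "\<not> last vs \<sim> hd Y"
    using ear_hd_nonadj1[OF e] ear_hd_nonadj1[OF ear_reverse[OF e]] ear_nonempty[OF e]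
      ear_hd_nonadj1[OF ear_swap[OF e]] ear_hd_nonadj1[OF ear_reverse[OF ear_swap[OF e]]]
    by (auto simp: hd_rev)
qed

lemma ear_cyc_adj:
  assumes e: "ear a X b Y vs"
  shows "a \<sim> hd X" "last X \<sim> b" "b \<sim> hd Y" "last Y \<sim> a"
  using e ear_nonempty[OF e]
  by (auto simp: ear_def longest_def cyc_def successively_Cons successively_append_iff)

lemma ear_distinct:
  assumes e: "ear a X b Y vs"
  shows "distinct (a # X @ b # Y)" "hd X \<in> set X" "last X \<in> set X" "hd Y \<in> set Y" "last Y \<in> set Y"
    "hd vs \<in> set vs" "last vs \<in> set vs" "set vs \<inter> set (a # X @ b # Y) = {}"
  using e ear_nonempty[OF e] by (auto simp: ear_def longest_def cyc_def link_def)

text \<open>Among the neighbours \<open>hd X\<close>, \<open>last Y\<close>, \<open>hd vs\<close> of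
  \<open>a\<close> the other two pairs are nonadjacent, so this edge must prevent the claw.\<close>

lemma ear_cross1: assumes e: "ear a X b Y vs" shows "hd X \<sim> last Y"
proof -
  have "a \<sim> hd X" "a \<sim> last Y" "a \<sim> hd vs"
    using ear_cyc_adj[OF e] e by (auto simp: ear_def link_def intro: adj_sym)
  moreover have "hd X \<noteq> last Y" "hd X \<noteq> hd vs" "last Y \<noteq> hd vs"
    using ear_distinct[OF e] by (auto simp: disjoint_iff)
  ultimately show ?thesis
    using claw_free[of a "hd X" "last Y" "hd vs"] ear_hd_nonadj[OF e] adj_sym by blast
qed

lemma ear_cross: assumes e: "ear a X b Y vs" shows "hd X \<sim> last Y" "last X \<sim> hd Y"
  using ear_cross1[OF e] ear_cross1[OF ear_swap[OF e]] adj_sym by auto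

text \<open>Running through the detour, then \<open>X\<close> backwards, then \<open>Y\<close> would
  give a longer cycle.\<close>

lemma ear_parallel1: assumes e: "ear a X b Y vs" shows "\<not> hd X \<sim> hd Y"
proof
  assume h: "hd X \<sim> hd Y"
  note ne = ear_nonempty[OF e]
  have c: "cyc (a # X @ b # Y)" and l: "link a vs b" and d: "set vs \<inter> set (a # X @ b # Y) = {}"
    using e by (auto simp: ear_def longest_def)
  have "cyc (a # vs @ b # rev X @ Y)"
    using c l d ne h ear_cyc_adj[OF e]
    by (auto simp: cyc_def link_def successively_Cons successively_append_iff hd_rev last_rev
        intro: adj_sym)
  then show False using e l by (fastforce simp: ear_def longest_def link_def)
qed

lemma ear_parallel: assumes e: "ear a X b Y vs" shows "\<not> hd X \<sim> hd Y" "\<not> last X \<sim> last Y"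
  using ear_parallel1[OF e] ear_parallel1[OF ear_reverse[OF e]] ear_nonempty[OF e]
  by (auto simp: hd_rev dest: adj_sym)

text \<open>Since \<open>ear_cross\<close> joins \<open>last X\<close> to \<open>hd Y\<close>, the
  detour followed by \<open>X\<close> and \<open>Y\<close>, both forwards, would close to a longer
  cycle.\<close>

lemma ear_diagonal1: assumes e: "ear a X b Y vs" shows "\<not> b \<sim> hd X"
proof
  assume h: "b \<sim> hd X"
  note ne = ear_nonempty[OF e]
  have c: "cyc (a # X @ b # Y)" and l: "link a vs b" and d: "set vs \<inter> set (a # X @ b # Y) = {}"
    using e by (auto simp: ear_def longest_def)
  have "cyc (a # vs @ b # X @ Y)"
    using c l d ne h ear_cyc_adj[OF e] ear_cross[OF e]
    by (auto simp: cyc_def link_def successively_Cons successively_append_iff)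
  then show False using e l by (fastforce simp: ear_def longest_def link_def)
qed

lemma ear_diagonal:
  assumes e: "ear a X b Y vs"
  shows "\<not> b \<sim> hd X" "\<not> b \<sim> last Y" "\<not> a \<sim> hd Y" "\<not> a \<sim> last X"
  using ear_diagonal1[OF e] ear_diagonal1[OF ear_reverse[OF e]] ear_diagonal1[OF ear_swap[OF e]]
    ear_diagonal1[OF ear_reverse[OF ear_swap[OF e]]] ear_nonempty[OF e]
  by (auto simp: hd_rev)

subsection \<open>Hamiltonicity\<close>

lemma ear_of_link:
  assumes "longest C" "a \<in> set C" "b \<in> set C" "a \<noteq> b" "link a vs b" "set vs \<inter> set C = {}"
  obtains X Y where "ear a X b Y vs" "set (a # X @ b # Y) = set C"
proof -
  obtain P Q where C: "C = P @ a # Q" using assms(2) by (meson split_list)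
  then have "b \<in> set (Q @ P)" using assms(3,4) by auto
  then obtain X Y where XY: "Q @ P = X @ b # Y" by (meson split_list)
  then have "set (a # X @ b # Y) = set C" unfolding C by (metis set_append Un_commute append_Cons)
  moreover have "longest (a # X @ b # Y)"
    using longest_rotate[of P "a # Q"] assms(1) XY unfolding C by simp
  ultimately have "ear a X b Y vs" using assms by (simp add: ear_def)
  then show ?thesis using that \<open>set (a # X @ b # Y) = set C\<close> by blast
qed

text \<open>Connectedness gives an edge from some \<open>a\<close> on the cycle to a vertex off it.
  Deleting \<open>a\<close> leaves the graph connected, so the part reached from there must have
  another neighbour on the cycle.\<close>

lemma exists_link:
  assumes "longest C" "v \<in> V" "v \<notin> set C"
  shows "\<exists>a\<in>set C. \<exists>b\<in>set C. a \<noteq> b \<and> (\<exists>vs. link a vs b \<and> set vs \<inter> set C = {})"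
proof -
  have C: "cyc C" using assms(1) by (simp add: longest_def)
  then have sub: "set C \<subseteq> V" and ne: "set C \<noteq> {}" using cyc_subset by (auto simp: cyc_def)
  obtain a w where aw: "a \<in> set C" "w \<notin> set C" "a \<sim> w"
  proof -
    have "\<exists>s\<in>set C. \<exists>t\<in>V - {} - set C. s \<sim> t"
      by (rule separation) (use sub ne assms(2,3) in auto)
    then show ?thesis using that by auto
  qed
  \<comment> \<open>A second vertex of the cycle ensures that \<open>S\<close> below is not all of
    \<open>V - {a}\<close>.\<close>
  obtain c where c: "c \<in> set C" "c \<noteq> a"
  proof -
    have "hd C \<in> set C" "last C \<in> set C" "hd C \<noteq> last C"
      using C adj_irrefl by (auto simp: cyc_def)
    then show ?thesis using that by metis
  qed
  \<comment> \<open>The vertices reached from \<open>a\<close> by paths running off the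
    cycle.\<close>
  define S where "S = {s. \<exists>vs. vs \<noteq> [] \<and> distinct vs \<and> successively (\<sim>) vs \<and> a \<sim> hd vs
    \<and> set vs \<subseteq> V - set C \<and> last vs = s}"
  have "w \<in> S" unfolding S_def using aw adj_V[OF adj_sym[OF aw(3)]] by (auto intro!: exI[of _ "[w]"])
  moreover have "S \<subseteq> V - set C" unfolding S_def using last_in_set by fastforce
  ultimately obtain s t where st: "s \<in> S" "t \<in> V - {a} - S" "s \<sim> t"
  proof -
    assume S: "w \<in> S" "S \<subseteq> V - set C"
    have "\<exists>s\<in>S. \<exists>t\<in>V - {a} - S. s \<sim> t"
      by (rule separation) (use S aw c sub in auto)
    then show ?thesis using that by auto
  qed
  obtain vs where vs: "vs \<noteq> []" "distinct vs" "successively (\<sim>) vs" "a \<sim> hd vs"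
    "set vs \<subseteq> V - set C" "last vs = s"
    using st(1) unfolding S_def by blast
  have "t \<in> set C"
  proof (rule ccontr)
    assume t: "t \<notin> set C"
    have "t \<in> S"
    \<comment> \<open>The path is either cut off at \<open>t\<close> or extended by
      \<open>t\<close>, so its vertices stay distinct.\<close>
    proof (cases "t \<in> set vs")
      case True
      then obtain ys zs where "vs = ys @ t # zs" by (meson split_list)
      then have "vs = (ys @ [t]) @ zs" by simp
      then show ?thesis unfolding S_def using vs
        by (intro CollectI exI[of _ "ys @ [t]"]) (auto simp: successively_append_iff hd_append)
    next
      case False
      then show ?thesis unfolding S_def using vs st t
        by (intro CollectI exI[of _ "vs @ [t]"]) (auto simp: successively_append_iff)
    qed
    then show False using st by blast
  qed
  then show ?thesis using st vs aw by (intro bexI[of _ a] bexI[of _ t] conjI exI[of _ vs]) (auto simp: link_def)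
qed

text \<open>The detour is shortest over all pairs of cycle vertices, so detours ending at
  \<open>x\<close>, the successor of \<open>a\<close>, are covered by \<open>short\<close> too. Two
  interior vertices would give an induced P5 on \<open>x\<close>, \<open>a\<close>,
  \<open>v1\<close>, \<open>v2\<close>, \<open>b\<close>, three or more one on \<open>x\<close>,
  \<open>a\<close>, \<open>v1\<close>, \<open>v2\<close>, \<open>v3\<close>.\<close>

lemma exists_short_ear:
  assumes L: "longest C" and "v \<in> V" "v \<notin> set C"
  obtains a X b Y w where "ear a X b Y [w]" "set (a # X @ b # Y) = set C"
proof -
  define Q where "Q n \<longleftrightarrow> (\<exists>a\<in>set C. \<exists>b\<in>set C. a \<noteq> b \<and>
    (\<exists>vs. link a vs b \<and> set vs \<inter> set C = {} \<and> length vs = n))" for n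
  obtain n where n: "Q n" and min: "\<And>k. k < n \<Longrightarrow> \<not> Q k"
    using exists_link[OF assms] exists_least_iff[of Q] unfolding Q_def by blast
  obtain a b vs where ab: "a \<in> set C" "b \<in> set C" "a \<noteq> b" and l: "link a vs b"
    and d: "set vs \<inter> set C = {}" and len: "length vs = n"
    using n unfolding Q_def by blast
  have short: "n \<le> length us" if "link x us y" "x \<in> set C" "y \<in> set C" "x \<noteq> y" "set us \<inter> set C = {}" for x us y
  proof -
    have "Q (length us)" using that unfolding Q_def by blast
    then show ?thesis using min not_le by blast
  qed
  obtain X Y where e: "ear a X b Y vs" and setC: "set (a # X @ b # Y) = set C"
    using ear_of_link[OF L ab l d] .
  define x where "x = hd X"
  have x: "x \<in> set C" "x \<noteq> a" "x \<noteq> b" "a \<sim> x" "\<not> b \<sim> x" "\<not> hd vs \<sim> x"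
    using ear_distinct[OF e] setC ear_cyc_adj[OF e] ear_diagonal[OF e] ear_hd_nonadj[OF e] x_def by auto
  show ?thesis
  proof (cases vs)
    case Nil then show ?thesis using l by (simp add: link_def)
  next
    case (Cons v1 rest)
    show ?thesis
    proof (cases rest)
      case Nil then show ?thesis using that e setC Cons by blast
    next
      case (Cons v2 rest')
      with \<open>vs = v1 # rest\<close> have vs: "vs = v1 # v2 # rest'" by simp
      have out: "v1 \<notin> set C" "v2 \<notin> set C" and v12: "a \<sim> v1" "v1 \<sim> v2" "v1 \<noteq> v2"
        using d l by (auto simp: vs link_def)
      have only_a: "\<not> v1 \<sim> c" if "c \<in> set C" "c \<noteq> a" for c
        using short[of a "[v1]" c] that v12 ab out len by (auto simp: link_def vs)
      show ?thesis
      proof (cases rest')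
        case Nil
        have v2b: "v2 \<sim> b" using l by (simp add: vs Nil link_def)
        have 1: "\<not> v2 \<sim> a" "\<not> v2 \<sim> x"
          using short[of b "[v2]" a] short[of x "[v2]" b] v2b ab x out len
          by (auto simp: link_def vs Nil dest: adj_sym)
        have "\<not> a \<sim> b"
          using claw_free[of a x v1 b] x v12 only_a out ab adj_sym by metis
        then show ?thesis
          using P5_free[of x a v1 v2 b] 1 x v12 v2b only_a ab adj_sym by metis
      next
        case (Cons v3 rest'')
        have v3: "v2 \<sim> v3" "v3 \<notin> set C" "v3 \<noteq> v1" "v3 \<noteq> v2" using l d by (auto simp: vs Cons link_def)
        have dd: "set (v3 # rest'') \<inter> set C = {}" using d by (auto simp: vs Cons)
        have "\<not> v1 \<sim> v3" using short[of a "v1 # v3 # rest''" b] l ab len dd out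
          by (auto simp: link_def vs Cons)
        moreover have "\<not> a \<sim> v2" using short[of a "v2 # v3 # rest''" b] l ab len dd out
          by (auto simp: link_def vs Cons)
        moreover have "\<not> a \<sim> v3" using short[of a "v3 # rest''" b] l ab len dd out
          by (auto simp: link_def vs Cons successively_Cons)
        moreover have "\<not> v2 \<sim> x" using short[of a "[v1, v2]" x] v12 ab x out len
          by (auto simp: link_def vs Cons)
        \<comment> \<open>Minimality may fail to help, as \<open>n\<close> can be 3; but
          \<open>x\<close> follows \<open>a\<close> on the cycle, so the three vertices could be
          inserted between them.\<close>
        moreover have "\<not> v3 \<sim> x"
        proof
          assume "v3 \<sim> x"
          then have "link a [v1, v2, v3] x" using v12 v3 by (auto simp: link_def)
          then have "link a [v1, v2, v3] (hd (X @ b # Y))"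
            using ear_nonempty[OF e] by (simp add: x_def)
          moreover have "set [v1, v2, v3] \<inter> set (a # X @ b # Y) = {}"
            using setC out v3 by auto
          ultimately show False using longest_no_link e by (auto simp: ear_def)
        qed
        ultimately show ?thesis
          using P5_free[of x a v1 v2 v3] x v12 v3 only_a adj_sym by metis
      qed
    qed
  qed
qed

section \<open>Ears with one interior vertex\<close>

text \<open>Otherwise \<open>hd X\<close>, \<open>a\<close>, \<open>v\<close>, \<open>b\<close>,
  \<open>hd Y\<close> would induce a P5.\<close>

lemma ear_ends_adj:
  assumes e: "ear a X b Y [v]" shows "a \<sim> b"
proof -
  have v: "a \<sim> v" "v \<sim> b" using e by (auto simp: ear_def link_def)
  note facts = ear_cyc_adj[OF e] ear_diagonal[OF e] ear_parallel[OF e] ear_hd_nonadj[OF e, simplified]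
  show ?thesis
    using P5_free[of "hd X" a v b "hd Y"] v facts adj_sym by metis
qed

text \<open>If \<open>u\<close> saw neither end, the path \<open>hd Y\<close>, \<open>b\<close>,
  \<open>a\<close>, \<open>hd X\<close>, \<open>u\<close> would force \<open>u\<close> to see
  \<open>hd Y\<close>. Having no claw at \<open>u\<close>, it would not see \<open>v\<close>, and
  \<open>v\<close>, \<open>b\<close>, \<open>hd Y\<close>, \<open>u\<close>, \<open>hd X\<close>
  would induce a P5.\<close>

lemma ear_hd_nbrs:
  assumes e: "ear a X b Y [v]" and u: "u \<sim> hd X" shows "u \<sim> a \<or> u \<sim> b"
proof (rule ccontr)
  assume nP: "\<not> (u \<sim> a \<or> u \<sim> b)"
  have v: "a \<sim> v" "v \<sim> b" using e by (auto simp: ear_def link_def)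
  note facts = ear_cyc_adj[OF e] ear_diagonal[OF e] ear_parallel[OF e] ear_hd_nonadj[OF e, simplified]
    ear_ends_adj[OF e]
  have neq: "v \<noteq> hd X" "v \<noteq> hd Y" "hd X \<noteq> hd Y" using ear_distinct[OF e] by auto
  have uY: "u \<sim> hd Y"
    using P5_free[of "hd Y" b a "hd X" u] facts u nP adj_sym by metis
  then have "\<not> u \<sim> v"
    using claw_free[of u v "hd X" "hd Y"] u facts neq by metis
  then show False
    using P5_free[of v b "hd Y" u "hd X"] facts u nP uY v adj_sym by metis
qed

lemma ear_end_nbrs:
  assumes e: "ear a X b Y [v]" and u: "u \<sim> z" and z: "z \<in> {hd X, last X, hd Y, last Y}"
  shows "u \<sim> a \<or> u \<sim> b"
proof -
  have e': "ear b Y a X [v]" using ear_swap[OF e] by simp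
  show ?thesis
    using z u ear_hd_nbrs[OF e, of u] ear_hd_nbrs[OF e', of u] ear_hd_nbrs[OF ear_reverse[OF e], of u]
      ear_hd_nbrs[OF ear_reverse[OF e'], of u] ear_nonempty[OF e]
    by (auto simp: hd_rev)
qed

text \<open>This carries adjacency to \<open>a\<close> or \<open>b\<close> from one vertex of the
  cycle to the next. Suppose \<open>u\<close> sees neither. If \<open>w\<close> sees both,
  claw-freeness at \<open>a\<close> and \<open>b\<close> joins \<open>w\<close> to
  \<open>hd X\<close> and \<open>hd Y\<close>, which form a claw at \<open>w\<close> with
  \<open>u\<close>; otherwise \<open>u\<close>, \<open>w\<close>, \<open>a\<close>,
  \<open>b\<close>, \<open>hd Y\<close> induce a P5.\<close>

lemma ear_not_outside1:
  assumes e: "ear a X b Y [v]" and w: "w \<sim> a" "w \<noteq> v" "\<not> w \<sim> v" and uw: "u \<sim> w"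
  shows "u \<sim> a \<or> u \<sim> b"
proof (rule ccontr)
  assume nP: "\<not> (u \<sim> a \<or> u \<sim> b)"
  have v: "a \<sim> v" "v \<sim> b" using e by (auto simp: ear_def link_def)
  note facts = ear_cyc_adj[OF e] ear_diagonal[OF e] ear_parallel[OF e] ear_hd_nonadj[OF e, simplified]
    ear_ends_adj[OF e]
  have neq: "v \<noteq> hd X" "v \<noteq> hd Y" "hd X \<noteq> hd Y" using ear_distinct[OF e] by auto
  have wn: "w \<noteq> hd X" "w \<noteq> hd Y" and un: "\<not> u \<sim> hd X" "\<not> u \<sim> hd Y"
    using ear_end_nbrs[OF e, of u] nP uw by auto
  show False
  proof (cases "w \<sim> b")
    case True
    have "w \<sim> hd X" using claw_free[of a w "hd X" v] w facts v neq wn adj_sym by metis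
    moreover have "w \<sim> hd Y" using claw_free[of b w "hd Y" v] w True facts v neq wn adj_sym by metis
    ultimately show False
      using claw_free[of w "hd X" "hd Y" u] uw un neq facts nP adj_sym by metis
  next
    case False
    have "\<not> w \<sim> hd Y"
      using claw_free[of w u a "hd Y"] uw w nP un facts adj_sym by metis
    then show False
      using P5_free[of u w a b "hd Y"] uw w nP un False facts adj_sym by metis
  qed
qed

lemma ear_not_outside:
  assumes e: "ear a X b Y [v]" and w: "w \<sim> a \<or> w \<sim> b" "w \<noteq> v" "\<not> w \<sim> v" and uw: "u \<sim> w"
  shows "u \<sim> a \<or> u \<sim> b"
  using ear_not_outside1[OF e _ w(2,3) uw] ear_not_outside1[OF ear_swap[OF e, simplified] _ w(2,3) uw] w(1) by auto

text \<open>Induction along \<open>X\<close>, starting from the neighbour \<open>hd X\<close> of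
  \<open>a\<close>; each step applies \<open>ear_not_outside\<close> to a vertex and its
  successor.\<close>

lemma ear_prefix:
  assumes e: "ear a X b Y [v]"
  shows "X = X1 @ X2 \<Longrightarrow> \<forall>x\<in>set X1. \<not> x \<sim> v \<Longrightarrow> x \<in> set X1 \<Longrightarrow> x \<sim> a \<or> x \<sim> b"
proof (induction X1 arbitrary: X2 x rule: rev_induct)
  case (snoc y X1)
  show ?case
  proof (cases "x = y")
    case False
    then show ?thesis using snoc.IH[of "y # X2" x] snoc.prems by auto
  next
    case True
    show ?thesis
    proof (cases "X1 = []")
      case True
      then show ?thesis using \<open>x = y\<close> snoc.prems ear_cyc_adj[OF e] adj_sym by auto
    next
      case False
      then have "last X1 \<in> set X1" by simp
      moreover have "last X1 \<sim> y"
        using e False by (auto simp: ear_def longest_def cyc_def snoc.prems successively_append_iff successively_Cons)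
      moreover have "v \<notin> set X" using ear_distinct[OF e] by simp
      ultimately show ?thesis
        using ear_not_outside[OF e, of "last X1" y] snoc.IH[of "y # X2" "last X1"] snoc.prems \<open>x = y\<close> adj_sym
        by auto
    qed
  qed
qed simp

text \<open>At the first neighbour \<open>c\<close> of \<open>v\<close> on \<open>X\<close>,
  \<open>v\<close> is also an ear between \<open>a\<close> and \<open>c\<close> and between
  \<open>b\<close> and \<open>c\<close>. By \<open>ear_diagonal\<close> the predecessor of
  \<open>c\<close> sees neither \<open>a\<close> nor \<open>b\<close>, against
  \<open>ear_prefix\<close>.\<close>

lemma ear_no_third1:
  assumes e: "ear a X b Y [v]" and c: "c \<in> set X" shows "\<not> c \<sim> v"
proof
  assume "c \<sim> v"
  with c obtain X1 c X2 where X: "X = X1 @ c # X2" and cv: "c \<sim> v" and X1: "\<forall>x\<in>set X1. \<not> x \<sim> v"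
    using split_list_first_prop[of X "\<lambda>x. x \<sim> v"] by blast
  have "X1 \<noteq> []" using ear_hd_nonadj[OF e] X cv adj_sym by auto
  then have l: "last X1 \<in> set X1" by simp
  have dis: "distinct (a # X @ b # Y)" "v \<notin> set (a # X @ b # Y)" using ear_distinct[OF e] by auto
  have av: "a \<sim> v" "v \<sim> b" and lo: "longest (a # X1 @ c # X2 @ b # Y)"
    using e X by (auto simp: ear_def link_def)
  have e1: "ear a X1 c (X2 @ b # Y) [v]"
    using lo dis X av cv by (auto simp: ear_def link_def intro: adj_sym)
  have "longest (b # (Y @ a # X1) @ c # X2)"
    using longest_rotate[of "a # X1 @ c # X2" "b # Y"] lo by simp
  then have e2: "ear b (Y @ a # X1) c X2 [v]"
    using dis X av cv by (auto simp: ear_def link_def intro: adj_sym)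
  have "\<not> a \<sim> last X1" "\<not> b \<sim> last X1"
    using ear_diagonal(4)[OF e1] ear_diagonal(4)[OF e2] \<open>X1 \<noteq> []\<close> by auto
  then show False using ear_prefix[OF e X X1 l] adj_sym by blast
qed

lemma ear_interior:
  assumes e: "ear a X b Y [v]" and z: "z \<in> set X \<union> set Y"
  shows "\<not> z \<sim> v" "z \<sim> a \<or> z \<sim> b"
proof -
  have e': "ear b Y a X [v]" using ear_swap[OF e] by simp
  show "\<not> z \<sim> v" using z ear_no_third1[OF e] ear_no_third1[OF e'] by blast
  show "z \<sim> a \<or> z \<sim> b"
    using z ear_prefix[OF e, of X "[]" z] ear_prefix[OF e', of Y "[]" z]
      ear_no_third1[OF e] ear_no_third1[OF e'] by auto
qed

lemma successively_clique:
  "distinct xs \<Longrightarrow> (\<And>x y. x \<in> set xs \<Longrightarrow> y \<in> set xs \<Longrightarrow> x \<noteq> y \<Longrightarrow> x \<sim> y) \<Longrightarrow> successively (\<sim>) xs"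
  by (induction xs rule: induct_list012) auto

text \<open>
  The interior vertices split into a clique of neighbours of \<open>a\<close> and a clique of neighbours of \<open>b\<close>
  joined by the edge \<open>s t\<close>, so there is a cycle through all of them, \<open>a\<close>, \<open>b\<close> and \<open>v\<close>.
\<close>

lemma no_short_ear: "\<not> ear a X b Y [v]"
proof
  assume e: "ear a X b Y [v]"
  note ne = ear_nonempty[OF e]
  have v: "a \<sim> v" "v \<sim> b" and vC: "v \<notin> set (a # X @ b # Y)" and dist: "distinct (a # X @ b # Y)"
    and sX: "successively (\<sim>) X"
    using e by (auto simp: ear_def link_def longest_def cyc_def successively_append_iff successively_Cons)
  have hdX: "hd X \<sim> a" and lX: "\<not> last X \<sim> a"
    using ear_cyc_adj[OF e] ear_diagonal[OF e] adj_sym by auto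
  \<comment> \<open>The segment \<open>X\<close> starts in the neighbourhood of \<open>a\<close> and
    ends outside it; \<open>t\<close> is its first vertex outside.\<close>
  obtain X1 t X2 where X: "X = X1 @ t # X2" and t: "\<not> t \<sim> a" and X1: "\<forall>x\<in>set X1. x \<sim> a"
    using split_list_first_prop[of X "\<lambda>x. \<not> x \<sim> a"] lX last_in_set[OF ne(1)] by blast
  define s where "s = last X1"
  have "X1 \<noteq> []" using X t hdX by auto
  then have s: "s \<in> set X1" "s \<sim> a" "s \<sim> t"
    using X1 sX by (auto simp: s_def X successively_append_iff)
  have tb: "t \<sim> b" using ear_interior[OF e, of t] t X by auto
  \<comment> \<open>The order of the entries of \<open>A\<close> and \<open>B\<close> is immaterial,
    as each of them is a clique.\<close>
  define A where "A = filter (\<lambda>z. z \<sim> a \<and> z \<noteq> s) (X @ Y)"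
  define B where "B = filter (\<lambda>z. \<not> z \<sim> a \<and> z \<noteq> t) (X @ Y)"
  have a_clique: "x \<sim> y" if "x \<sim> a" "y \<sim> a" "x \<in> set X \<union> set Y" "y \<in> set X \<union> set Y" "x \<noteq> y" for x y
    using claw_free[of a x y v] that v ear_interior[OF e] vC adj_sym by (metis UnCI UnE set_append list.set_intros(2))
  have b_clique: "x \<sim> y" if "\<not> x \<sim> a" "\<not> y \<sim> a" "x \<in> set X \<union> set Y" "y \<in> set X \<union> set Y" "x \<noteq> y" for x y
  proof -
    have "x \<sim> b" "y \<sim> b" "\<not> x \<sim> v" "\<not> y \<sim> v" using that ear_interior[OF e] by auto
    moreover have "x \<noteq> v" "y \<noteq> v" using that vC by auto
    ultimately show ?thesis using claw_free[of b x y v] that v adj_sym by metis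
  qed
  have sX: "s \<in> set X" "t \<in> set X" using s X by auto
  have "cyc (v # a # A @ s # t # B @ [b])"
  proof -
    have A: "x \<sim> y" if "x \<in> set (A @ [s])" "y \<in> set (A @ [s])" "x \<noteq> y" for x y
      by (rule a_clique) (use that s sX in \<open>auto simp: A_def\<close>)
    have B: "x \<sim> y" if "x \<in> set (t # B)" "y \<in> set (t # B)" "x \<noteq> y" for x y
      by (rule b_clique) (use that t sX in \<open>auto simp: B_def\<close>)
    have "successively (\<sim>) (A @ [s])"
    proof (rule successively_clique)
      show "distinct (A @ [s])" using dist by (auto simp: A_def)
    qed (fact A)
    moreover have "successively (\<sim>) (t # B)"
    proof (rule successively_clique)
      show "distinct (t # B)" using dist by (auto simp: B_def)
    qed (fact B)
    moreover have "distinct (v # a # A @ s # t # B @ [b])"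
      using vC dist sX s t unfolding A_def B_def by auto
    moreover have "hd (A @ [s]) \<sim> a"
    proof (cases "A = []")
      case False
      then have "hd A \<in> set A" by simp
      then have "hd A \<sim> a" by (auto simp: A_def)
      then show ?thesis using False by simp
    qed (use s in simp)
    moreover have "last (t # B) \<sim> b"
    proof (cases "B = []")
      case False
      then have "last B \<in> set B" by simp
      then show ?thesis using False ear_interior(2)[OF e, of "last B"] by (auto simp: B_def)
    qed (use tb in simp)
    ultimately show ?thesis using v s
      by (auto simp: cyc_def successively_append_iff successively_Cons hd_append split: if_splits dest: adj_sym)
  qed
  \<comment> \<open>The new cycle contains \<open>v\<close> and all vertices of the old one, so
    counting shows it to be longer.\<close>
  moreover have "set (v # a # A @ s # t # B @ [b]) = insert v (set (a # X @ b # Y))"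
    unfolding A_def B_def using sX s t by auto
  moreover have "card (insert v (set (a # X @ b # Y))) = Suc (length (a # X @ b # Y))"
    using vC dist distinct_card[OF dist] by (metis List.finite_set card_insert_disjoint)
  ultimately have "length (v # a # A @ s # t # B @ [b]) = Suc (length (a # X @ b # Y))"
    by (metis cyc_def distinct_card)
  then show False
    using e \<open>cyc (v # a # A @ s # t # B @ [b])\<close> by (fastforce simp: ear_def longest_def)
qed

lemma hamiltonian:
  assumes "2 \<le> card V" shows "\<exists>xs. cyc xs \<and> length xs = card V"
proof -
  obtain u where u: "u \<in> V" using assms by (cases "V = {}") auto
  moreover have "V \<noteq> {u}" using assms by auto
  ultimately obtain w where "u \<sim> w" using separation[of "{}" "{u}"] by auto
  then have "cyc [u, w]" using adj_sym adj_neq by (auto simp: cyc_def)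
  then have "\<exists>C. cyc C \<and> (\<forall>ys. cyc ys \<longrightarrow> length ys \<le> length C)"
    by (rule ex_has_greatest_nat[where b = "Suc (card V)"]) (simp add: less_Suc_eq_le cyc_length_le)
  then obtain C where L: "longest C" unfolding longest_def by blast
  have "v \<in> set C" if "v \<in> V" for v
    by (rule ccontr) (use exists_short_ear[OF L \<open>v \<in> V\<close>] no_short_ear in metis)
  then have "set C = V" using L cyc_subset[of C] by (auto simp: longest_def)
  then show ?thesis using L distinct_card[of C] by (auto simp: longest_def cyc_def)
qed

subsection \<open>Shorter cycles and chords\<close>

text \<open>The pairs in \<open>zip xs (rotate1 xs)\<close> are the ones that later become the arcs
  of a cycle in the digraph.\<close>

definition chorded :: "'a list \<Rightarrow> bool" where
  "chorded xs \<longleftrightarrow> cyc xs \<and> (\<exists>u\<in>set xs. \<exists>v\<in>set xs. u \<sim> v \<and>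
     (u, v) \<notin> set (zip xs (rotate1 xs)) \<and> (v, u) \<notin> set (zip xs (rotate1 xs)))"

text \<open>The only consecutive pair starting at \<open>u\<close> ends at \<open>hd A\<close>, and
  the only one ending at \<open>u\<close> starts at \<open>last B\<close>.\<close>

lemma chordedI:
  assumes c: "cyc (u # A @ v # B)" and ne: "A \<noteq> []" "B \<noteq> []" and uv: "u \<sim> v"
  shows "chorded (u # A @ v # B)"
proof -
  obtain a A' where A: "A = a # A'" using ne by (cases A) auto
  obtain z B' where B: "B = B' @ [z]" using ne by (cases B rule: rev_cases) auto
  have d: "distinct (u # A @ v # B)" using c by (simp add: cyc_def)
  have "(u, v) \<notin> set (zip (u # A @ v # B) (A @ v # B @ [u]))"
    using d by (auto simp: A dest: set_zip_leftD)
  moreover have "(v, u) \<notin> set (zip (u # A @ v # B) (A @ v # B @ [u]))"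
  proof -
    have "zip (u # A @ v # B) (A @ v # B @ [u]) = zip ((u # A @ v # B') @ [z]) ((A @ v # B) @ [u])"
      by (simp add: B)
    also have "\<dots> = zip (u # A @ v # B') (A @ v # B) @ [(z, u)]"
      by (subst zip_append) (auto simp: B)
    finally show ?thesis using d by (auto simp: B dest: set_zip_rightD)
  qed
  ultimately show ?thesis using c uv by (auto simp: chorded_def)
qed

lemma cyc_rotate1: "cyc (x # xs) \<Longrightarrow> cyc (xs @ [x])"
  using cyc_rotate[of "[x]" xs] by simp

text \<open>From length 6 on, even \<open>c1\<close> and \<open>c5\<close> are nonconsecutive, so
  each adjacency offered by \<open>P5_free\<close> is a chord.\<close>

lemma long_cyc_chorded:
  assumes c: "cyc xs" and len: "6 \<le> length xs"
  shows "\<exists>ys. chorded ys \<and> length ys = length xs"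
proof -
  obtain c1 c2 c3 c4 c5 c6 zs where xs: "xs = c1 # c2 # c3 # c4 # c5 # c6 # zs"
    using len by (auto simp: numeral_eq_Suc Suc_le_length_iff)
  note 1 = c[unfolded xs]
  note 2 = cyc_rotate1[OF 1, simplified]
  note 3 = cyc_rotate1[OF 2, simplified]
  have "c1 \<sim> c2" "c2 \<sim> c3" "c3 \<sim> c4" "c4 \<sim> c5" using 1 by (auto simp: cyc_def)
  then consider "c1 \<sim> c3" | "c1 \<sim> c4" | "c1 \<sim> c5" | "c2 \<sim> c4" | "c2 \<sim> c5" | "c3 \<sim> c5"
    using P5_free by blast
  then show ?thesis
  proof cases
    assume "c1 \<sim> c3"
    then show ?thesis using chordedI[of c1 "[c2]" c3 "c4 # c5 # c6 # zs"] 1 xs by force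
  next
    assume "c1 \<sim> c4"
    then show ?thesis using chordedI[of c1 "[c2, c3]" c4 "c5 # c6 # zs"] 1 xs by force
  next
    assume "c1 \<sim> c5"
    then show ?thesis using chordedI[of c1 "[c2, c3, c4]" c5 "c6 # zs"] 1 xs by force
  next
    assume "c2 \<sim> c4"
    then show ?thesis using chordedI[of c2 "[c3]" c4 "c5 # c6 # zs @ [c1]"] 2 xs by force
  next
    assume "c2 \<sim> c5"
    then show ?thesis using chordedI[of c2 "[c3, c4]" c5 "c6 # zs @ [c1]"] 2 xs by force
  next
    assume "c3 \<sim> c5"
    then show ?thesis using chordedI[of c3 "[c4]" c5 "c6 # zs @ [c1, c2]"] 3 xs by force
  qed
qed

lemma shorter_cyc:
  assumes c: "cyc xs" and len: "6 \<le> length xs"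
  shows "\<exists>ys. cyc ys \<and> length ys = length xs - 1"
proof (rule ccontr)
  assume "\<nexists>ys. cyc ys \<and> length ys = length xs - 1"
  then have none: "length ys \<noteq> length xs - 1" if "cyc ys" for ys using that by blast
  have dist2: "\<not> c1 \<sim> c3" if "cyc (c1 # c2 # c3 # zs)" "length (c1 # c2 # c3 # zs) = length xs" for c1 c2 c3 zs
  proof
    assume "c1 \<sim> c3"
    then have "cyc (c1 # c3 # zs)" using that(1) by (auto simp: cyc_def)
    then show False using none that(2) by force
  qed
  \<comment> \<open>A chord spanning 3 edges forces the edge between \<open>c2\<close> and
    \<open>c6\<close>; rerouting along \<open>c1\<close>, \<open>c4\<close>, \<open>c3\<close>,
    \<open>c2\<close>, \<open>c6\<close> then omits just \<open>c5\<close>.\<close>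
  have dist3: "\<not> c1 \<sim> c4" if cc: "cyc (c1 # c2 # c3 # c4 # c5 # zs)"
    and ll: "length (c1 # c2 # c3 # c4 # c5 # zs) = length xs" for c1 c2 c3 c4 c5 zs
  proof
    assume 14: "c1 \<sim> c4"
    obtain c6 rs where zs: "zs = c6 # rs" using ll len by (cases zs) auto
    note 1 = cc[unfolded zs]
    note 2 = cyc_rotate1[OF 1, simplified]
    note 3 = cyc_rotate1[OF 2, simplified]
    note 4 = cyc_rotate1[OF 3, simplified]
    have n: "\<not> c2 \<sim> c4" "\<not> c3 \<sim> c5" "\<not> c4 \<sim> c6"
      using dist2[OF 2] dist2[OF 3] dist2[OF 4] ll zs by auto
    have a: "c1 \<sim> c2" "c2 \<sim> c3" "c3 \<sim> c4" "c4 \<sim> c5" "c5 \<sim> c6"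
      and d: "distinct [c1, c2, c3, c4, c5, c6]"
      using 1 by (auto simp: cyc_def)
    have "c2 \<sim> c6"
    proof -
      consider "c2 \<sim> c6" | "c3 \<sim> c6" | "c2 \<sim> c5" using P5_free[of c2 c3 c4 c5 c6] a n by blast
      then show ?thesis
      proof cases
        assume "c3 \<sim> c6"
        then show ?thesis using claw_free[of c3 c2 c4 c6] a n d adj_sym by auto
      next
        assume "c2 \<sim> c5"
        then show ?thesis using claw_free[of c5 c4 c6 c2] a n d adj_sym by auto
      qed
    qed
    then have "cyc (c1 # c4 # c3 # c2 # c6 # rs)"
      using 1 14 by (auto simp: cyc_def adj_commute successively_Cons split: if_splits)
    then show False using none ll zs by force
  qed
  have dist4: "c1 \<sim> c5" if cc: "cyc (c1 # c2 # c3 # c4 # c5 # zs)"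
    and ll: "length (c1 # c2 # c3 # c4 # c5 # zs) = length xs" for c1 c2 c3 c4 c5 zs
  proof -
    obtain c6 rs where zs: "zs = c6 # rs" using ll len by (cases zs) auto
    note 1 = cc[unfolded zs]
    note 2 = cyc_rotate1[OF 1, simplified]
    note 3 = cyc_rotate1[OF 2, simplified]
    have "\<not> c1 \<sim> c3" "\<not> c2 \<sim> c4" "\<not> c3 \<sim> c5" "\<not> c1 \<sim> c4" "\<not> c2 \<sim> c5"
      using dist2[OF 1] dist2[OF 2] dist2[OF 3] dist3[OF 1] dist3[OF 2] ll zs by auto
    then show ?thesis using P5_free[of c1 c2 c3 c4 c5] cc by (auto simp: cyc_def)
  qed
  obtain c1 c2 c3 c4 c5 c6 zs where xs: "xs = c1 # c2 # c3 # c4 # c5 # c6 # zs"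
    using len by (auto simp: numeral_eq_Suc Suc_le_length_iff)
  note 1 = c[unfolded xs]
  note 2 = cyc_rotate1[OF 1, simplified]
  note 3 = cyc_rotate1[OF 2, simplified]
  note 4 = cyc_rotate1[OF 3, simplified]
  note 5 = cyc_rotate1[OF 4, simplified]
  have 15: "c1 \<sim> c5" and 26: "c2 \<sim> c6" using dist4[OF 1] dist4[OF 2] xs by auto
  \<comment> \<open>In length 6 or 7 the chord from \<open>c1\<close> to \<open>c5\<close> spans
    only 2 or 3 edges the other way round.\<close>
  show False
  proof (cases zs)
    case Nil
    then show False using dist2[OF 5[unfolded Nil, simplified]] 15 xs adj_sym by auto
  next
    case (Cons c7 zs')
    show False
    proof (cases zs')
      case Nil
      then show False using dist3[of c5 c6 c7 c1 c2 "[c3, c4]"] 5 15 xs Cons adj_sym by auto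
    next
      case (Cons c8 rs)
      with \<open>zs = c7 # zs'\<close> have zs: "zs = c7 # c8 # rs" by simp
      have "c4 \<sim> c8" using dist4[OF 4[unfolded zs, simplified]] xs zs by auto
      \<comment> \<open>Three chords spanning 4 edges are used, and only \<open>c7\<close> is left
        out.\<close>
      then have "cyc (c1 # c5 # c6 # c2 # c3 # c4 # c8 # rs)"
        using 1 15 26 zs by (auto simp: cyc_def adj_commute)
      then show False using none xs zs by force
    qed
  qed
qed

lemma cyc_of_length:
  assumes "5 \<le> m" "m \<le> card V"
  shows "\<exists>xs. cyc xs \<and> length xs = m"
  using assms(2,1)
proof (induction rule: inc_induct)
  case base
  then show ?case using hamiltonian by simp
next
  case (step m)
  then obtain xs where "cyc xs" "length xs = Suc m" by auto
  then show ?case using shorter_cyc[of xs] step.prems by auto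
qed

lemma outside_neighbour:
  assumes "S \<subseteq> V" "S \<noteq> {}" "card S < card V"
  obtains s u where "s \<in> S" "u \<in> V" "u \<notin> S" "u \<sim> s"
proof -
  have "V - S \<noteq> {}" using assms by auto
  then have "\<exists>s\<in>S. \<exists>u\<in>V - {} - S. s \<sim> u"
    by (intro separation) (use assms in auto)
  then show ?thesis using that adj_sym by blast
qed

section \<open>Chorded cycles of length 5\<close>

definition pentagon :: "'a \<Rightarrow> 'a \<Rightarrow> 'a \<Rightarrow> 'a \<Rightarrow> 'a \<Rightarrow> bool" where
  "pentagon c1 c2 c3 c4 c5 \<longleftrightarrow> c1 \<sim> c2 \<and> c2 \<sim> c3 \<and> c3 \<sim> c4 \<and> c4 \<sim> c5 \<and> c5 \<sim> c1 \<and>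
     \<not> c1 \<sim> c3 \<and> \<not> c2 \<sim> c4 \<and> \<not> c3 \<sim> c5 \<and> \<not> c4 \<sim> c1 \<and> \<not> c5 \<sim> c2"

lemma pentagon_rotate: "pentagon c1 c2 c3 c4 c5 \<Longrightarrow> pentagon c2 c3 c4 c5 c1"
  by (simp add: pentagon_def)

lemma pentagon_distinct: "pentagon c1 c2 c3 c4 c5 \<Longrightarrow> distinct [c1, c2, c3, c4, c5]"
  using adj_irrefl adj_sym unfolding pentagon_def by auto

lemma pentagon_nbr1:
  assumes p: "pentagon c1 c2 c3 c4 c5" and u: "u \<sim> c1" "u \<notin> {c1, c2, c3, c4, c5}"
  shows "u \<sim> c2 \<or> u \<sim> c5"
  using claw_free[of c1 u c2 c5] pentagon_distinct[OF p] p u adj_sym unfolding pentagon_def by auto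

text \<open>Otherwise \<open>u\<close>, \<open>c2\<close>, \<open>c3\<close>, \<open>c4\<close>,
  \<open>c5\<close> would induce a P5.\<close>

lemma pentagon_nbr2:
  assumes p: "pentagon c1 c2 c3 c4 c5" and u: "u \<sim> c1" "u \<sim> c2"
  shows "u \<sim> c3 \<or> u \<sim> c4 \<or> u \<sim> c5"
  using P5_free[of u c2 c3 c4 c5] p u adj_sym unfolding pentagon_def by blast

text \<open>Every neighbour of \<open>u\<close> on the pentagon has another next to it, and two
  consecutive ones bring a third. If that one lies opposite, it brings a neighbour next to
  itself.\<close>

lemma pentagon_nbr3:
  assumes p: "pentagon c1 c2 c3 c4 c5" and u: "u \<notin> {c1, c2, c3, c4, c5}" "s \<in> {c1, c2, c3, c4, c5}" "u \<sim> s"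
  shows "(u \<sim> c1 \<and> u \<sim> c2 \<and> u \<sim> c3) \<or> (u \<sim> c2 \<and> u \<sim> c3 \<and> u \<sim> c4) \<or> (u \<sim> c3 \<and> u \<sim> c4 \<and> u \<sim> c5)
    \<or> (u \<sim> c4 \<and> u \<sim> c5 \<and> u \<sim> c1) \<or> (u \<sim> c5 \<and> u \<sim> c1 \<and> u \<sim> c2)"
proof -
  note p2 = pentagon_rotate[OF p]
  note p3 = pentagon_rotate[OF p2]
  note p4 = pentagon_rotate[OF p3]
  note p5 = pentagon_rotate[OF p4]
  have u': "u \<notin> {c2, c3, c4, c5, c1}" "u \<notin> {c3, c4, c5, c1, c2}" "u \<notin> {c4, c5, c1, c2, c3}"
    "u \<notin> {c5, c1, c2, c3, c4}" using u by auto
  have s: "u \<sim> c1 \<or> u \<sim> c2 \<or> u \<sim> c3 \<or> u \<sim> c4 \<or> u \<sim> c5" using u by auto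
  note one = pentagon_nbr1[OF p _ u(1)] pentagon_nbr1[OF p2 _ u'(1)] pentagon_nbr1[OF p3 _ u'(2)]
    pentagon_nbr1[OF p4 _ u'(3)] pentagon_nbr1[OF p5 _ u'(4)]
  note two = pentagon_nbr2[OF p, of u] pentagon_nbr2[OF p2, of u] pentagon_nbr2[OF p3, of u]
    pentagon_nbr2[OF p4, of u] pentagon_nbr2[OF p5, of u]
  show ?thesis using s one two by satx
qed

text \<open>The centre is \<open>c2\<close>; rotating the arguments gives the five possible types of
  \<open>u\<close>.\<close>

definition centred :: "'a \<Rightarrow> 'a \<Rightarrow> 'a \<Rightarrow> 'a \<Rightarrow> 'a \<Rightarrow> 'a \<Rightarrow> bool" where
  "centred c1 c2 c3 c4 c5 u \<longleftrightarrow> u \<notin> {c1, c2, c3, c4, c5} \<and> u \<sim> c1 \<and> u \<sim> c2 \<and> u \<sim> c3 \<and> \<not> u \<sim> c4 \<and> \<not> u \<sim> c5"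

text \<open>The chord joins \<open>u\<close> and \<open>w\<close>: otherwise they would form a claw
  at \<open>c1\<close> with \<open>c5\<close>.\<close>

lemma centred_same:
  assumes p: "pentagon c1 c2 c3 c4 c5" and u: "centred c1 c2 c3 c4 c5 u" and w: "centred c1 c2 c3 c4 c5 w"
    and "u \<noteq> w"
  shows "chorded [u, c3, w, c2, c1]"
proof -
  have "u \<sim> w" using claw_free[of c1 u w c5] p u w \<open>u \<noteq> w\<close> adj_sym unfolding pentagon_def centred_def by auto
  moreover have "cyc [u, c3, w, c2, c1]"
    using pentagon_distinct[OF p] p u w \<open>u \<noteq> w\<close> adj_sym unfolding pentagon_def centred_def cyc_def by auto
  ultimately show ?thesis using chordedI[of u "[c3]" w "[c2, c1]"] by simp
qed

text \<open>Going from \<open>c3\<close> to \<open>c2\<close> through \<open>w\<close> and back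
  through \<open>c1\<close> and \<open>u\<close> leaves the edge between \<open>c2\<close> and
  \<open>c3\<close> as a chord.\<close>

lemma centred_next:
  assumes p: "pentagon c1 c2 c3 c4 c5" and u: "centred c1 c2 c3 c4 c5 u" and w: "centred c2 c3 c4 c5 c1 w"
  shows "chorded [c3, w, c2, c1, u]"
proof -
  have "cyc [c3, w, c2, c1, u]"
    using pentagon_distinct[OF p] p u w adj_sym unfolding pentagon_def centred_def cyc_def by auto
  moreover have "c3 \<sim> c2" using p adj_sym by (simp add: pentagon_def)
  ultimately show ?thesis using chordedI[of c3 "[w]" c2 "[c1, u]"] by simp
qed

lemma four_nbrs_chorded:
  assumes p: "pentagon c1 c2 c3 c4 c5" and u: "u \<notin> {c1, c2, c3, c4, c5}" "u \<sim> c1" "u \<sim> c2" "u \<sim> c3" "u \<sim> c4"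
  shows "chorded [u, c1, c2, c3, c4]"
proof -
  have "cyc [u, c1, c2, c3, c4]"
    using pentagon_distinct[OF p] p u adj_sym unfolding pentagon_def cyc_def by auto
  then show ?thesis using chordedI[of u "[c1]" c2 "[c3, c4]"] u by simp
qed

lemma pentagon_centred:
  assumes p: "pentagon c1 c2 c3 c4 c5" and u: "u \<notin> {c1, c2, c3, c4, c5}" "s \<in> {c1, c2, c3, c4, c5}" "u \<sim> s"
    and none: "\<nexists>xs. chorded xs \<and> length xs = 5"
  shows "centred c1 c2 c3 c4 c5 u \<or> centred c2 c3 c4 c5 c1 u \<or> centred c3 c4 c5 c1 c2 u
    \<or> centred c4 c5 c1 c2 c3 u \<or> centred c5 c1 c2 c3 c4 u"
proof -
  note p2 = pentagon_rotate[OF p]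
  note p3 = pentagon_rotate[OF p2]
  note p4 = pentagon_rotate[OF p3]
  note p5 = pentagon_rotate[OF p4]
  have four: "\<not> (u \<sim> d1 \<and> u \<sim> d2 \<and> u \<sim> d3 \<and> u \<sim> d4)"
    if "pentagon d1 d2 d3 d4 d5" "u \<notin> {d1, d2, d3, d4, d5}" for d1 d2 d3 d4 d5
    using none four_nbrs_chorded[OF that] by force
  have "\<not> (u \<sim> c1 \<and> u \<sim> c2 \<and> u \<sim> c3 \<and> u \<sim> c4)" "\<not> (u \<sim> c2 \<and> u \<sim> c3 \<and> u \<sim> c4 \<and> u \<sim> c5)"
    "\<not> (u \<sim> c3 \<and> u \<sim> c4 \<and> u \<sim> c5 \<and> u \<sim> c1)" "\<not> (u \<sim> c4 \<and> u \<sim> c5 \<and> u \<sim> c1 \<and> u \<sim> c2)"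
    "\<not> (u \<sim> c5 \<and> u \<sim> c1 \<and> u \<sim> c2 \<and> u \<sim> c3)"
    by (rule four[OF p] four[OF p2] four[OF p3] four[OF p4] four[OF p5]; use u in blast)+
  then show ?thesis using pentagon_nbr3[OF p u] u(1) unfolding centred_def by auto
qed

text \<open>Otherwise there is an induced pentagon, and every other vertex is centred at one of its
  vertices. Three others exist, and their centres are pairwise distinct and nonconsecutive, which is
  impossible on five places.\<close>

lemma chorded_5:
  assumes V: "8 \<le> card V" shows "\<exists>xs. chorded xs \<and> length xs = 5"
proof (rule ccontr)
  assume none: "\<nexists>xs. chorded xs \<and> length xs = 5"
  obtain xs where "cyc xs" "length xs = 5" using cyc_of_length[of 5] V by auto
  then obtain c1 c2 c3 c4 c5 where 1: "cyc [c1, c2, c3, c4, c5]"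
    by (auto simp: numeral_eq_Suc length_Suc_conv)
  note 2 = cyc_rotate1[OF 1, simplified]
  note 3 = cyc_rotate1[OF 2, simplified]
  note 4 = cyc_rotate1[OF 3, simplified]
  note 5 = cyc_rotate1[OF 4, simplified]
  have nochord: "\<not> x \<sim> z" if "cyc [x, y, z, v, w]" for x y z v w
    using chordedI[of x "[y]" z "[v, w]"] that none by force
  have p: "pentagon c1 c2 c3 c4 c5"
    using 1 nochord[OF 1] nochord[OF 2] nochord[OF 3] nochord[OF 4] nochord[OF 5]
    by (auto simp: pentagon_def cyc_def)
  note p2 = pentagon_rotate[OF p]
  note p3 = pentagon_rotate[OF p2]
  note p4 = pentagon_rotate[OF p3]
  note p5 = pentagon_rotate[OF p4]
  define C where "C = {c1, c2, c3, c4, c5}"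
  define W where "W = C \<union> {u. \<exists>s\<in>C. u \<sim> s}"
  have CV: "C \<subseteq> V" using cyc_subset[OF 1] by (simp add: C_def)
  have ty: "centred c1 c2 c3 c4 c5 u \<or> centred c2 c3 c4 c5 c1 u \<or> centred c3 c4 c5 c1 c2 u
    \<or> centred c4 c5 c1 c2 c3 u \<or> centred c5 c1 c2 c3 c4 u" if "u \<in> W - C" for u
  proof -
    obtain s where "s \<in> C" "u \<sim> s" using \<open>u \<in> W - C\<close> by (auto simp: W_def)
    then show ?thesis using pentagon_centred[OF p _ _ _ none, of u s] \<open>u \<in> W - C\<close> by (simp add: C_def)
  qed
  have "V \<subseteq> W"
  proof (rule ccontr)
    assume "\<not> V \<subseteq> W"
    moreover have WV: "W \<subseteq> V" using CV adj_V by (auto simp: W_def)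
    ultimately have "card W < card V" using finite_V by (intro psubset_card_mono) auto
    moreover have "W \<noteq> {}" by (auto simp: W_def C_def)
    ultimately obtain s t where st: "s \<in> W" "t \<notin> W" "t \<sim> s" using outside_neighbour WV by metis
    then have s: "s \<in> W - C" by (auto simp: W_def)
    have t: "\<not> t \<sim> c1" "\<not> t \<sim> c2" "\<not> t \<sim> c3" "\<not> t \<sim> c4" "\<not> t \<sim> c5" "t \<notin> {c1, c2, c3, c4, c5}"
      using st by (auto simp: W_def C_def)
    \<comment> \<open>A vertex \<open>t\<close> beyond the neighbourhood of the pentagon would form
      a claw at \<open>s\<close> with two nonadjacent neighbours of \<open>s\<close> on it.\<close>
    have no: "\<not> centred d1 d2 d3 d4 d5 s" if "pentagon d1 d2 d3 d4 d5" "\<not> t \<sim> d1" "\<not> t \<sim> d3" "t \<noteq> d1" "t \<noteq> d3"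
      for d1 d2 d3 d4 d5
      using claw_free[of s t d1 d3] that st pentagon_distinct[OF that(1)] adj_sym[OF st(3)]
      unfolding centred_def pentagon_def by auto
    show False
      using ty[OF s] no[OF p] no[OF p2] no[OF p3] no[OF p4] no[OF p5] t by auto
  qed
  have "card C \<le> 5" unfolding C_def by (simp add: card_insert_if)
  then have "3 \<le> card (V - C)" using V CV finite_V card_Diff_subset[of C V] finite_subset[of C V] by auto
  then obtain T where "T \<subseteq> V - C" "card T = 3" using obtain_subset_with_card_n by metis
  moreover from this obtain u v w where "T = {u, v, w}" "u \<noteq> v" "u \<noteq> w" "v \<noteq> w"
    by (auto simp: card_3_iff)
  ultimately have uvw: "u \<in> W - C" "v \<in> W - C" "w \<in> W - C" "u \<noteq> v" "u \<noteq> w" "v \<noteq> w"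
    using \<open>V \<subseteq> W\<close> by auto
  have same: "x = y" if "pentagon d1 d2 d3 d4 d5" "centred d1 d2 d3 d4 d5 x" "centred d1 d2 d3 d4 d5 y"
    for d1 d2 d3 d4 d5 x y
    using centred_same[OF that] none by force
  have nxt: "\<not> (centred d1 d2 d3 d4 d5 x \<and> centred d2 d3 d4 d5 d1 y)" if "pentagon d1 d2 d3 d4 d5"
    for d1 d2 d3 d4 d5 x y
    using centred_next[OF that, of x y] none by force
  note S = same[OF p] same[OF p2] same[OF p3] same[OF p4] same[OF p5]
  note N = nxt[OF p] nxt[OF p2] nxt[OF p3] nxt[OF p4] nxt[OF p5]
  show False
    using ty[OF uvw(1)] ty[OF uvw(2)] ty[OF uvw(3)] S N uvw(4-6) by metis
qed

section \<open>Chorded cycles of length 4\<close>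

lemma diamond_chorded:
  assumes "x \<sim> z" "x \<sim> y" "y \<sim> z" "x \<sim> w" "w \<sim> z" "y \<noteq> w"
  shows "chorded [x, y, z, w]"
proof -
  have "cyc [x, y, z, w]" using assms adj_sym adj_neq by (auto simp: cyc_def)
  then show ?thesis using chordedI[of x "[y]" z "[w]"] assms by simp
qed

text \<open>Two triangles joined by two edges; the pair \<open>c2\<close>, \<open>c5\<close> is left
  open, so a third joining edge is allowed.\<close>

definition bitriangle :: "'a \<Rightarrow> 'a \<Rightarrow> 'a \<Rightarrow> 'a \<Rightarrow> 'a \<Rightarrow> 'a \<Rightarrow> bool" where
  "bitriangle c1 c2 c3 c4 c5 c6 \<longleftrightarrow> distinct [c1, c2, c3, c4, c5, c6] \<and> c1 \<sim> c2 \<and> c2 \<sim> c3 \<and> c3 \<sim> c1 \<and>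
     c4 \<sim> c5 \<and> c5 \<sim> c6 \<and> c6 \<sim> c4 \<and> c3 \<sim> c4 \<and> c6 \<sim> c1"

context
  \<comment> \<open>Absence of chorded 4-cycles, put as uniqueness of the common neighbour of two
    adjacent vertices.\<close>
  assumes diamond_free: "\<And>x y z w. \<lbrakk>x \<sim> z; x \<sim> y; y \<sim> z; x \<sim> w; w \<sim> z\<rbrakk> \<Longrightarrow> y = w"
begin

text \<open>An outside neighbour sees three consecutive vertices, and its edge to the middle one has
  the other two as common neighbours.\<close>

lemma no_pentagon:
  assumes V: "6 \<le> card V" shows "\<not> pentagon c1 c2 c3 c4 c5"
proof
  assume p: "pentagon c1 c2 c3 c4 c5"
  have d: "distinct [c1, c2, c3, c4, c5]" using pentagon_distinct[OF p] .
  have "{c1, c2, c3, c4, c5} \<subseteq> V" using p adj_V by (auto simp: pentagon_def)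
  moreover have "card {c1, c2, c3, c4, c5} < card V" using V d by simp
  ultimately obtain s u where su: "s \<in> {c1, c2, c3, c4, c5}" "u \<notin> {c1, c2, c3, c4, c5}" "u \<sim> s"
    using outside_neighbour[of "{c1, c2, c3, c4, c5}"] by (metis insert_not_empty)
  have no: "\<not> (u \<sim> x \<and> u \<sim> y \<and> u \<sim> z)" if "x \<sim> y" "y \<sim> z" "x \<noteq> z" for x y z
    using diamond_free[of u y x z] that adj_sym by blast
  show False
    using pentagon_nbr3[OF p su(2,1,3)] no[of c1 c2 c3] no[of c2 c3 c4] no[of c3 c4 c5] no[of c4 c5 c1]
      no[of c5 c1 c2] p d unfolding pentagon_def by auto
qed

text \<open>Such a \<open>u\<close> cannot see \<open>c2\<close>, so by claw-freeness at
  \<open>c1\<close> it sees \<open>c6\<close>; then \<open>u\<close>, \<open>c6\<close>,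
  \<open>c4\<close>, \<open>c3\<close>, \<open>c2\<close> induce a P5.\<close>

lemma bitriangle_corner_nbr:
  assumes b: "bitriangle c1 c2 c3 c4 c5 c6" and u: "u \<notin> {c1, c2, c3, c4, c5, c6}"
  shows "\<not> u \<sim> c1"
proof
  assume u1: "u \<sim> c1"
  have a: "c1 \<sim> c2" "c2 \<sim> c3" "c3 \<sim> c1" "c4 \<sim> c5" "c5 \<sim> c6" "c6 \<sim> c4" "c3 \<sim> c4" "c6 \<sim> c1"
    and d: "distinct [c1, c2, c3, c4, c5, c6]"
    using b by (auto simp: bitriangle_def)
  note a' = a a[THEN adj_sym]
  have n: "\<not> c2 \<sim> c4" "\<not> c2 \<sim> c6" "\<not> c6 \<sim> c3"
    using diamond_free[of c2 c3 c1 c4] diamond_free[of c1 c2 c3 c6] diamond_free[of c1 c3 c2 c6] a' d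
    by (auto simp: adj_commute)
  have u2: "\<not> u \<sim> c2" "\<not> u \<sim> c3"
    using diamond_free[of c1 c2 c3 u] diamond_free[of c1 c3 c2 u] a' u u1 adj_sym[OF u1] by auto
  have u6: "u \<sim> c6" using claw_free[of c1 c2 c6 u] u2 a' u adj_sym[OF u1] n d by (auto simp: adj_commute)
  have u4: "\<not> u \<sim> c4" using diamond_free[of c6 c4 c5 u] a' u u6 adj_sym[OF u6] by auto
  show False
    using P5_free[of u c6 c4 c3 c2] a' n u2 u4 u6 by (auto simp: adj_commute)
qed

lemma bitriangle_no_nbr:
  assumes b: "bitriangle c1 c2 c3 c4 c5 c6" and u: "u \<notin> {c1, c2, c3, c4, c5, c6}"
    and s: "s \<in> {c1, c2, c3, c4, c5, c6}"
  shows "\<not> u \<sim> s"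
proof -
  \<comment> \<open>The corners being excluded, a neighbour \<open>u\<close> of \<open>d2\<close>
    would start an induced P5 \<open>u\<close>, \<open>d2\<close>, \<open>d1\<close>,
    \<open>d6\<close>, \<open>d4\<close>.\<close>
  have mid: "\<not> u \<sim> d2" if b: "bitriangle d1 d2 d3 d4 d5 d6" and u: "u \<notin> {d1, d2, d3, d4, d5, d6}"
    for d1 d2 d3 d4 d5 d6
  proof
    assume u2: "u \<sim> d2"
    have b': "bitriangle d6 d5 d4 d3 d2 d1" "bitriangle d4 d5 d6 d1 d2 d3"
      using b by (auto simp: bitriangle_def adj_commute)
    have n: "\<not> u \<sim> d1" "\<not> u \<sim> d6" "\<not> u \<sim> d4"
      using bitriangle_corner_nbr[OF b u] bitriangle_corner_nbr[OF b'(1), of u]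
        bitriangle_corner_nbr[OF b'(2), of u] u by auto
    have a: "d1 \<sim> d2" "d2 \<sim> d3" "d3 \<sim> d1" "d4 \<sim> d5" "d5 \<sim> d6" "d6 \<sim> d4" "d3 \<sim> d4" "d6 \<sim> d1"
      and d: "distinct [d1, d2, d3, d4, d5, d6]"
      using b by (auto simp: bitriangle_def)
    note a' = a a[THEN adj_sym]
    have "\<not> d2 \<sim> d4" "\<not> d2 \<sim> d6" "\<not> d1 \<sim> d4"
      using diamond_free[of d2 d3 d1 d4] diamond_free[of d1 d2 d3 d6] diamond_free[of d1 d3 d2 d4] a' d
      by (auto simp: adj_commute)
    then show False using P5_free[of u d2 d1 d6 d4] a' n u2 by auto
  qed
  have b': "bitriangle c3 c2 c1 c6 c5 c4" "bitriangle c6 c5 c4 c3 c2 c1" "bitriangle c4 c5 c6 c1 c2 c3"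
    using b by (auto simp: bitriangle_def adj_commute)
  show ?thesis
    using s u bitriangle_corner_nbr[OF b u] bitriangle_corner_nbr[OF b'(1), of u]
      bitriangle_corner_nbr[OF b'(2), of u] bitriangle_corner_nbr[OF b'(3), of u]
      mid[OF b u] mid[OF b'(3)] by auto
qed

text \<open>The chord cuts off the 5-cycle \<open>c1\<close>, \<open>c3\<close>, \<open>c4\<close>,
  \<open>c5\<close>, \<open>c6\<close>. It is not induced, and every chord of it other than the one
  between \<open>c4\<close> and \<open>c6\<close> is excluded.\<close>

lemma hexagon_bitriangle:
  assumes V: "6 \<le> card V" and c: "cyc [c1, c2, c3, c4, c5, c6]" and 13: "c1 \<sim> c3"
  shows "bitriangle c1 c2 c3 c4 c5 c6"
proof -
  have a: "c1 \<sim> c2" "c2 \<sim> c3" "c3 \<sim> c4" "c4 \<sim> c5" "c5 \<sim> c6" "c6 \<sim> c1"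
    and d: "distinct [c1, c2, c3, c4, c5, c6]"
    using c by (auto simp: cyc_def)
  note a' = a a[THEN adj_sym] 13 adj_sym[OF 13]
  have no35: "\<not> d3 \<sim> d5"
    if c: "cyc [d1, d2, d3, d4, d5, d6]" and 13: "d1 \<sim> d3" for d1 d2 d3 d4 d5 d6
  proof
    assume 35: "d3 \<sim> d5"
    have a: "d1 \<sim> d2" "d2 \<sim> d3" "d3 \<sim> d4" "d4 \<sim> d5" "d5 \<sim> d6" "d6 \<sim> d1"
      and d: "distinct [d1, d2, d3, d4, d5, d6]"
      using c by (auto simp: cyc_def)
    note a' = a a[THEN adj_sym] 13 adj_sym[OF 13] 35 adj_sym[OF 35]
    have "\<not> d2 \<sim> d6" using diamond_free[of d2 d1 d3 d6] a' d by auto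
    moreover have "\<not> d2 \<sim> d5" using diamond_free[of d2 d3 d1 d5] a' d by auto
    moreover have "\<not> d2 \<sim> d4" using diamond_free[of d2 d3 d1 d4] a' d by auto
    moreover have "\<not> d1 \<sim> d5" using diamond_free[of d1 d3 d2 d5] a' d by auto
    moreover have "\<not> d1 \<sim> d4" using diamond_free[of d1 d3 d2 d4] a' d by auto
    moreover have "\<not> d6 \<sim> d4" using diamond_free[of d4 d5 d3 d6] a' d adj_sym[of d6 d4] by auto
    ultimately show False using P5_free[of d2 d1 d6 d5 d4] a' by blast
  qed
  \<comment> \<open>Reflecting the hexagon keeps the chord and turns \<open>no35\<close> into the
    statement for \<open>c1\<close> and \<open>c5\<close>.\<close>
  have r: "cyc [c3, c2, c1, c6, c5, c4]"
    using cyc_rotate[of "[c6, c5, c4]" "[c3, c2, c1]"] cyc_rev[OF c] by simp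
  have "\<not> c3 \<sim> c5" "\<not> c1 \<sim> c5" using no35[OF c 13] no35[OF r adj_sym[OF 13]] by simp_all
  moreover have "\<not> c1 \<sim> c4" "\<not> c6 \<sim> c3"
    using diamond_free[of c1 c3 c2 c4] diamond_free[of c1 c3 c2 c6] a' d by (auto simp: adj_commute)
  moreover have "\<not> pentagon c1 c3 c4 c5 c6" using no_pentagon[OF V] .
  ultimately have "c4 \<sim> c6" using a' unfolding pentagon_def by (metis adj_sym)
  then have "c6 \<sim> c4" by (rule adj_sym)
  then show ?thesis using a' d by (simp add: bitriangle_def)
qed

text \<open>A 6-cycle with a chord between vertices two apart is a bitriangle, to which no seventh
  vertex attaches. Without such chords claw-freeness removes the opposite ones needed, and
  \<open>c1\<close> to \<open>c5\<close> induce a P5.\<close>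

lemma diamond_free_small: "card V < 7"
proof (rule ccontr)
  assume "\<not> card V < 7"
  then have V: "7 \<le> card V" by simp
  obtain xs where "cyc xs" "length xs = 6" using cyc_of_length[of 6] V by auto
  then obtain c1 c2 c3 c4 c5 c6 where 1: "cyc [c1, c2, c3, c4, c5, c6]"
    by (auto simp: numeral_eq_Suc length_Suc_conv)
  note 2 = cyc_rotate1[OF 1, simplified]
  note 3 = cyc_rotate1[OF 2, simplified]
  note 4 = cyc_rotate1[OF 3, simplified]
  note 5 = cyc_rotate1[OF 4, simplified]
  note 6 = cyc_rotate1[OF 5, simplified]
  have no13: "\<not> d1 \<sim> d3" if c: "cyc [d1, d2, d3, d4, d5, d6]" for d1 d2 d3 d4 d5 d6
  proof
    assume "d1 \<sim> d3"
    then have b: "bitriangle d1 d2 d3 d4 d5 d6" using hexagon_bitriangle c V by simp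
    have "card {d1, d2, d3, d4, d5, d6} < card V" using b V by (simp add: bitriangle_def)
    moreover have "{d1, d2, d3, d4, d5, d6} \<subseteq> V" using cyc_subset[OF c] by simp
    ultimately obtain s u where "s \<in> {d1, d2, d3, d4, d5, d6}" "u \<notin> {d1, d2, d3, d4, d5, d6}" "u \<sim> s"
      using outside_neighbour[of "{d1, d2, d3, d4, d5, d6}"] by (metis insert_not_empty)
    then show False using bitriangle_no_nbr[OF b] by blast
  qed
  note n = no13[OF 1] no13[OF 2] no13[OF 3] no13[OF 4] no13[OF 5] no13[OF 6]
  have a: "c1 \<sim> c2" "c2 \<sim> c3" "c3 \<sim> c4" "c4 \<sim> c5" "c5 \<sim> c6" "c6 \<sim> c1"
    and d: "distinct [c1, c2, c3, c4, c5, c6]"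
    using 1 by (auto simp: cyc_def)
  note a' = a a[THEN adj_sym]
  have "\<not> c1 \<sim> c4" "\<not> c2 \<sim> c5"
    using claw_free[of c1 c2 c6 c4] claw_free[of c2 c1 c3 c5] a' n d by (auto simp: adj_commute)
  then show False using P5_free[of c1 c2 c3 c4 c5] a' n by (auto simp: adj_commute)
qed

end

lemma chorded_4: assumes "7 \<le> card V" shows "\<exists>xs. chorded xs \<and> length xs = 4"
proof (rule ccontr)
  assume "\<nexists>xs. chorded xs \<and> length xs = 4"
  then have "y = w" if "x \<sim> z" "x \<sim> y" "y \<sim> z" "x \<sim> w" "w \<sim> z" for x y z w
    using diamond_chorded[OF that] by force
  then have "card V < 7" by (rule diamond_free_small)
  then show False using assms by simp
qed

lemma chorded_of_length:
  assumes "8 \<le> card V" "4 \<le> m" "m \<le> card V"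
  shows "\<exists>xs. chorded xs \<and> length xs = m"
proof -
  consider "m = 4" | "m = 5" | "6 \<le> m" using assms by linarith
  then show ?thesis
  proof cases
    case 3
    then obtain xs where "cyc xs" "length xs = m" using cyc_of_length[of m] assms by auto
    then show ?thesis using long_cyc_chorded[of xs] 3 by auto
  qed (use assms chorded_4 chorded_5 in auto)
qed

end

subsection \<open>Digraphs of the library\<close>

text \<open>A vertex map preserving adjacency and nonadjacency is turned into an isomorphism record
  of the library, so that \<open>induced_free\<close> can be applied.\<close>

lemma induced_copy:
  assumes G: "wf_digraph G" "nomulti_digraph G" and F: "parcs F \<subseteq> pverts F \<times> pverts F"
    and inj: "inj_on f (pverts F)" and sub: "f ` pverts F \<subseteq> verts G"
    and arcs: "\<And>i j. i \<in> pverts F \<Longrightarrow> j \<in> pverts F \<Longrightarrow> (f i, f j) \<in> arcs_ends G \<longleftrightarrow> (i, j) \<in> parcs F"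
  shows "\<exists>H. induced_subgraph H G \<and> digraph_iso H (with_proj F)"
proof -
  interpret wf_digraph G by fact
  interpret nomulti_digraph G by fact
  define H where "H = G \<restriction> (f ` pverts F)"
  define g where "g = the_inv_into (pverts F) f"
  have gf: "g (f i) = i" if "i \<in> pverts F" for i
    using that inj by (simp add: g_def the_inv_into_f_f)
  \<comment> \<open>Arcs of the pattern are pairs, so an arc goes to the pair of images of its ends;
    this is injective because there are no parallel arcs.\<close>
  define hom where "hom = \<lparr>iso_verts = g, iso_arcs = (\<lambda>e. (g (tail G e), g (head G e))),
    iso_head = snd, iso_tail = fst\<rparr>"
  have ind: "induced_subgraph H G" unfolding H_def using sub by (rule induced_induce)
  have "wf_digraph H" unfolding H_def by (rule wellformed_induce_subgraph)
  moreover have "inj_on g (f ` pverts F)" by (auto simp: inj_on_def gf)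
  moreover have "inj_on (\<lambda>e. (g (tail G e), g (head G e))) (arcs H)"
  proof (rule inj_onI)
    fix d e assume "d \<in> arcs H" "e \<in> arcs H" "(g (tail G d), g (head G d)) = (g (tail G e), g (head G e))"
    then have "d \<in> arcs G" "e \<in> arcs G" "arc_to_ends G d = arc_to_ends G e"
      by (auto simp: H_def arc_to_ends_def gf)
    then show "d = e" by (rule no_multi_arcs)
  qed
  ultimately have iso: "pre_digraph.digraph_isomorphism H hom"
    by (simp add: pre_digraph.digraph_isomorphism_def hom_def H_def)
  have "(\<lambda>e. (g (tail G e), g (head G e))) ` arcs H = parcs F"
  proof (intro equalityI subsetI)
    fix p assume "p \<in> (\<lambda>e. (g (tail G e), g (head G e))) ` arcs H"
    then obtain e i j where e: "e \<in> arcs G" "tail G e = f i" "head G e = f j" "i \<in> pverts F" "j \<in> pverts F"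
      "p = (i, j)"
      by (auto simp: H_def gf)
    then have "(f i, f j) \<in> arcs_ends G" by (force simp: arcs_ends_def arc_to_ends_def)
    then show "p \<in> parcs F" using e arcs by simp
  next
    fix p assume p: "p \<in> parcs F"
    then obtain i j where ij: "p = (i, j)" "i \<in> pverts F" "j \<in> pverts F" using F by auto
    then have "(f i, f j) \<in> arcs_ends G" using p arcs by simp
    then obtain e where "e \<in> arcs G" "tail G e = f i" "head G e = f j"
      by (auto simp: arcs_ends_def arc_to_ends_def)
    then show "p \<in> (\<lambda>e. (g (tail G e), g (head G e))) ` arcs H"
      using ij by (intro image_eqI[of _ _ e]) (auto simp: H_def gf)
  qed
  moreover have "g ` f ` pverts F = pverts F" by (force simp: gf)
  ultimately have "app_iso hom H = with_proj F"
    by (simp add: app_iso_def hom_def H_def with_proj_def)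
  then show ?thesis using ind iso by (metis digraph_iso_def)
qed

text \<open>If no arc crossed, everything reachable from a vertex of \<open>S\<close> would stay in
  \<open>S\<close>.\<close>

lemma connected_crossing_arc:
  assumes "connected H" "S \<subseteq> verts H" "S \<noteq> {}" "verts H - S \<noteq> {}"
  shows "\<exists>s\<in>S. \<exists>t\<in>verts H - S. (s, t) \<in> (arcs_ends H)\<^sup>s"
proof (rule ccontr)
  assume none: "\<not> ?thesis"
  obtain u v where uv: "u \<in> S" "v \<in> verts H - S" using assms by blast
  then have "(u, v) \<in> rtrancl_on (verts H) ((arcs_ends H)\<^sup>s)"
    using assms by (auto simp: connected_conv)
  moreover have "w \<in> S" if "(u, w) \<in> rtrancl_on (verts H) ((arcs_ends H)\<^sup>s)" for w
    using that by (induction rule: rtrancl_on_induct) (use uv none in blast)+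
  ultimately show False using uv by blast
qed

lemma (in pre_digraph) cycle_of_vertices:
  assumes e: "\<And>u v. (u, v) \<in> set (zip xs (rotate1 xs)) \<Longrightarrow> e (u, v) \<in> arcs G \<and> arc_to_ends G (e (u, v)) = (u, v)"
    and xs: "distinct xs" "xs \<noteq> []" "set xs \<subseteq> verts G"
  shows "cycle (map e (zip xs (rotate1 xs)))"
proof -
  obtain x ys where x: "xs = x # ys" using xs by (cases xs) auto
  \<comment> \<open>The end \<open>w\<close> is kept independent of the start for the induction; the
    cycle is the case where both are \<open>x\<close>.\<close>
  have walk: "cas y (map e (zip (y # zs) (zs @ [w]))) w \<and> awalk_verts y (map e (zip (y # zs) (zs @ [w]))) = y # zs @ [w]"
    if "\<And>u v. (u, v) \<in> set (zip (y # zs) (zs @ [w])) \<Longrightarrow> e (u, v) \<in> arcs G \<and> arc_to_ends G (e (u, v)) = (u, v)"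
    for y zs w
    using that by (induction zs arbitrary: y) (auto simp: arc_to_ends_def)
  have "cas x (map e (zip xs (rotate1 xs))) x \<and> awalk_verts x (map e (zip xs (rotate1 xs))) = x # ys @ [x]"
    using walk[of x ys x] e by (simp add: x)
  moreover have "set (map e (zip xs (rotate1 xs))) \<subseteq> arcs G" using e by auto
  moreover have "map e (zip xs (rotate1 xs)) \<noteq> []" by (simp add: x)
  ultimately show ?thesis using xs by (auto simp: cycle_def awalk_def x)
qed

context claw_P5_free
begin

lemma cyc_zip_adj: assumes "cyc xs" "(u, v) \<in> set (zip xs (rotate1 xs))" shows "u \<sim> v"
proof -
  obtain x ys where x: "xs = x # ys" using assms by (cases xs) auto
  have "\<forall>(u, v) \<in> set (zip (y # zs) (zs @ [w])). u \<sim> v"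
    if "successively (\<sim>) (y # zs)" "last (y # zs) \<sim> w" for y zs w
    using that by (induction zs arbitrary: y) auto
  then show ?thesis using assms by (fastforce simp: cyc_def x)
qed

end

lemma claw_P5_free_of_graph:
  assumes G: "graph G" and con: "k_connected 2 G"
    and free: "induced_free {with_proj (star_graph 3), with_proj (path_graph 5)} G"
  shows "claw_P5_free (verts G) (\<lambda>u v. (u, v) \<in> arcs_ends G)"
proof -
  interpret graph G by fact
  have sym: "(v, u) \<in> arcs_ends G" if "(u, v) \<in> arcs_ends G" for u v
    using sym_arcs that by (auto simp: symmetric_def dest: symD)
  have irr: "(u, u) \<notin> arcs_ends G" for u
    using no_loops by (fastforce simp: arcs_ends_def arc_to_ends_def)
  have ver: "u \<in> verts G" if "(u, v) \<in> arcs_ends G" for u v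
    using that by (auto simp: arcs_ends_def arc_to_ends_def)
  note copy = induced_copy[OF wf_digraph nomulti_digraph]
  show ?thesis
  proof
    fix c x y z
    assume a: "(c, x) \<in> arcs_ends G" "(c, y) \<in> arcs_ends G" "(c, z) \<in> arcs_ends G"
      and n: "x \<noteq> y" "x \<noteq> z" "y \<noteq> z"
    show "(x, y) \<in> arcs_ends G \<or> (x, z) \<in> arcs_ends G \<or> (y, z) \<in> arcs_ends G"
    proof (rule ccontr)
      assume no: "\<not> ?thesis"
      have S: "{0..3::nat} = {0, 1, 2, 3}" "{1..3::nat} = {1, 2, 3}" by auto
      note a' = a a[THEN sym]
      have no': "(x, y) \<notin> arcs_ends G" "(x, z) \<notin> arcs_ends G" "(y, z) \<notin> arcs_ends G"
        "(y, x) \<notin> arcs_ends G" "(z, x) \<notin> arcs_ends G" "(z, y) \<notin> arcs_ends G"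
        using no sym by blast+
      have cn: "c \<noteq> x" "c \<noteq> y" "c \<noteq> z" using a irr by auto
      \<comment> \<open>Index 0 is the centre of the star, so \<open>c\<close> comes first.\<close>
      let ?f = "\<lambda>i. [c, x, y, z] ! i"
      have "\<exists>H. induced_subgraph H G \<and> digraph_iso H (with_proj (star_graph 3))"
      proof (rule copy[where f = ?f])
        show "inj_on ?f (pverts (star_graph 3))" using n cn by (simp add: star_graph_def S)
        show "?f ` pverts (star_graph 3) \<subseteq> verts G" using a' ver by (simp add: star_graph_def S)
        fix i j assume "i \<in> pverts (star_graph 3)" "j \<in> pverts (star_graph 3)"
        then have "i \<in> {0, 1, 2, 3}" "j \<in> {0, 1, 2, 3}" by (auto simp: star_graph_def S)
        then show "(?f i, ?f j) \<in> arcs_ends G \<longleftrightarrow> (i, j) \<in> parcs (star_graph 3)"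
          by (elim insertE emptyE; hypsubst) (simp_all add: star_graph_def S irr a' no')
      qed (auto simp: star_graph_def)
      then show False using free unfolding induced_free_def by blast
    qed
  next
    fix a b c d e
    assume p: "(a, b) \<in> arcs_ends G" "(b, c) \<in> arcs_ends G" "(c, d) \<in> arcs_ends G" "(d, e) \<in> arcs_ends G"
    show "(a, c) \<in> arcs_ends G \<or> (a, d) \<in> arcs_ends G \<or> (a, e) \<in> arcs_ends G \<or> (b, d) \<in> arcs_ends G
      \<or> (b, e) \<in> arcs_ends G \<or> (c, e) \<in> arcs_ends G"
    proof (rule ccontr)
      assume no: "\<not> ?thesis"
      have S: "{..<5::nat} = {0, 1, 2, 3, 4}" by auto
      note p' = p p[THEN sym]
      have no': "(a, c) \<notin> arcs_ends G" "(a, d) \<notin> arcs_ends G" "(a, e) \<notin> arcs_ends G"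
        "(b, d) \<notin> arcs_ends G" "(b, e) \<notin> arcs_ends G" "(c, e) \<notin> arcs_ends G"
        "(c, a) \<notin> arcs_ends G" "(d, a) \<notin> arcs_ends G" "(e, a) \<notin> arcs_ends G"
        "(d, b) \<notin> arcs_ends G" "(e, b) \<notin> arcs_ends G" "(e, c) \<notin> arcs_ends G"
        using no sym by blast+
      have "distinct [a, b, c, d, e]" using p' no' irr by auto
      let ?f = "\<lambda>i. [a, b, c, d, e] ! i"
      have "\<exists>H. induced_subgraph H G \<and> digraph_iso H (with_proj (path_graph 5))"
      proof (rule copy[where f = ?f])
        show "inj_on ?f (pverts (path_graph 5))"
          using \<open>distinct [a, b, c, d, e]\<close> by (simp add: path_graph_def S)
        show "?f ` pverts (path_graph 5) \<subseteq> verts G" using p' ver by (simp add: path_graph_def S)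
        fix i j assume "i \<in> pverts (path_graph 5)" "j \<in> pverts (path_graph 5)"
        then have "i \<in> {0, 1, 2, 3, 4}" "j \<in> {0, 1, 2, 3, 4}" by (auto simp: path_graph_def)
        then show "(?f i, ?f j) \<in> arcs_ends G \<longleftrightarrow> (i, j) \<in> parcs (path_graph 5)"
          by (elim insertE emptyE; hypsubst) (simp_all add: path_graph_def irr p' no')
      qed (auto simp: path_graph_def)
      then show False using free unfolding induced_free_def by blast
    qed
  next
    fix A S
    assume A: "A \<subseteq> verts G" "card A < 2" and S: "S \<subseteq> verts G - A" "S \<noteq> {}" "verts G - A - S \<noteq> {}"
    have "connected (G \<restriction> (verts G - A))" using con A by (simp add: k_connected_def)
    then have "\<exists>s\<in>S. \<exists>t\<in>verts G - A - S. (s, t) \<in> (arcs_ends (G \<restriction> (verts G - A)))\<^sup>s"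
      using connected_crossing_arc[of "G \<restriction> (verts G - A)" S] S by simp
    then show "\<exists>s\<in>S. \<exists>t\<in>verts G - A - S. (s, t) \<in> arcs_ends G"
      using sym by (fastforce simp: symcl_def arcs_ends_def arc_to_ends_def)
  qed (use sym irr ver in auto)
qed

theorem theorem9:
  fixes G :: "('a, 'b) pre_digraph"
  assumes "graph G"
    and "k_connected 2 G"
    and "8 \<le> card (verts G)"
    and "induced_free {with_proj (star_graph 3), with_proj (path_graph 5)} G"
  shows "chorded_pancyclic G"
  unfolding chorded_pancyclic_def
proof (intro allI impI)
  fix m assume m: "4 \<le> m \<and> m \<le> card (verts G)"
  interpret graph G by fact
  interpret claw_P5_free "verts G" "\<lambda>u v. (u, v) \<in> arcs_ends G"
    by (rule claw_P5_free_of_graph) fact+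
  obtain xs where "chorded xs" and len: "length xs = m"
    using chorded_of_length assms(3) m by blast
  then obtain u v where c: "cyc xs" and uv: "u \<in> set xs" "v \<in> set xs" "(u, v) \<in> arcs_ends G"
    "(u, v) \<notin> set (zip xs (rotate1 xs))" "(v, u) \<notin> set (zip xs (rotate1 xs))"
    unfolding chorded_def by blast
  \<comment> \<open>A choice of one arc for each ordered adjacent pair turns the vertex list into an
    arc list.\<close>
  define e where "e uv = (SOME e. e \<in> arcs G \<and> arc_to_ends G e = uv)" for uv
  have e: "e uv \<in> arcs G \<and> arc_to_ends G (e uv) = uv" if "uv \<in> arcs_ends G" for uv
    unfolding e_def by (rule someI_ex) (use that in \<open>auto simp: arcs_ends_def\<close>)
  have zip_arc: "e uv \<in> arcs G \<and> arc_to_ends G (e uv) = uv" if "uv \<in> set (zip xs (rotate1 xs))" for uv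
    using e cyc_zip_adj[OF c] that by (cases uv) auto
  define p where "p = map e (zip xs (rotate1 xs))"
  have "cycle p" unfolding p_def
    by (rule cycle_of_vertices) (use zip_arc c cyc_subset[OF c] in \<open>auto simp: cyc_def\<close>)
  \<comment> \<open>The arcs of \<open>p\<close> have exactly the consecutive pairs of
    \<open>xs\<close> as ends, so the chord remains a chord.\<close>
  moreover have ends: "arc_to_ends G ` set p = set (zip xs (rotate1 xs))"
    using zip_arc by (force simp: p_def image_image)
  moreover have "tail G ` set p = set xs"
  proof -
    have "tail G ` set p = fst ` arc_to_ends G ` set p" by (auto simp: arc_to_ends_def image_image)
    also have "\<dots> = set (map fst (zip xs (rotate1 xs)))" by (simp only: ends set_map)
    also have "\<dots> = set xs" by (subst map_fst_zip) simp_all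
    finally show ?thesis .
  qed
  ultimately have "chorded_cycle G p"
    using uv len m by (auto simp: chorded_cycle_def p_def)
  then show "\<exists>p. chorded_cycle G p \<and> length p = m" using len by (auto simp: p_def)
qed

end
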